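(* Let $H$ be a finite simple graph containing an odd closed walk $\gamma$ such that $[\gamma]^2=1$ in the reduced homotopy group $\Pi_1^*(H)$. Then for every $d\ge 1$, every free continuous $\mathbb Z^d$-action on a zero-dimensional Polish space admits a continuous homomorphism from its standard Schreier graph to $H$.
   Context: A walk in $H$ is a finite sequence $(v_0,\dots,v_m)$ of vertices with consecutive ones adjacent (repetitions allowed); its length is $m$; it is closed if $v_0=v_m$, and odd if $m$ is odd. For a vertex $b$, $\Pi_1(H,b)$ is the group of closed walks based at $b$ modulo insertion and deletion of spurs $(u,v,u)$, with concatenation as multiplication. $\Pi_1^*(H,b)$ is the quotient of $\Pi_1(H,b)$ by the normal subgroup generated by all classes $[\lambda\sigma\lambda^{-1}]$, where $\sigma$ is any closed walk of length four (possibly with repeated vertices) in the component of $b$ and $\lambda$ is a walk from $b$ to the start of $\sigma$. $[\gamma]$ denotes the class of $\gamma$ in $\Pi_1^*(H,b)$, with $b$ the starting vertex of $\gamma$ (if $H$ is disconnected, one uses the component containing $\gamma$); the condition $[\gamma]^2=1$ does not depend on the base point. A space is zero-dimensional if it has a base of clopen sets. An action is free if $g\cdot x=x$ implies $g=0$. The standard Schreier graph of a free $\mathbb Z^d$-space $X$ joins $x$ to $e_i\cdot x$ for $1\le i\le d$, with $e_1,\dots,e_d$ the standard generators. A continuous homomorphism to $H$ is a continuous map $c:X\to V(H)$ ($V(H)$ discrete) taking adjacent points to adjacent vertices. *)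

theory Defs
  imports
    "HOL-Analysis.Analysis"
    "HOL-Algebra.Coset"
    "Graph_Theory.Graph_Theory"
begin

text \<open>
  Finite simple graphs are the structures satisfying \<open>pair_graph\<close>: finite, loop-free, symmetric
  digraphs whose arcs are pairs of vertices.  A walk is the nonempty list of its vertices
  (\<open>vwalk\<close>), and \<open>vwalk_length\<close> counts its arcs, so that walks of length four have five entries.
\<close>

section \<open>Closed walks up to spurs\<close>

definition loops_at :: "'v pair_pre_digraph \<Rightarrow> 'v \<Rightarrow> 'v list set" where
  "loops_at H b = {p. vwalk p (with_proj H) \<and> hd p = b \<and> last p = b}"

definition closed_vwalk :: "'v pair_pre_digraph \<Rightarrow> 'v list \<Rightarrow> bool" where
  "closed_vwalk H p \<longleftrightarrow> vwalk p (with_proj H) \<and> hd p = last p"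

text \<open>Adjacency of \<open>u\<close> and \<open>v\<close> is enforced by both lists being walks.\<close>

definition spur_insertion :: "'v pair_pre_digraph \<Rightarrow> 'v \<Rightarrow> 'v list rel" where
  "spur_insertion H b =
     {(p, q). p \<in> loops_at H b \<and> q \<in> loops_at H b \<and>
        (\<exists>xs u v ys. p = xs @ [u] @ ys \<and> q = xs @ [u, v, u] @ ys)}"

definition spur_equiv :: "'v pair_pre_digraph \<Rightarrow> 'v \<Rightarrow> 'v list rel" where
  "spur_equiv H b =
     (spur_insertion H b \<union> (spur_insertion H b)\<inverse>)\<^sup>* \<inter> loops_at H b \<times> loops_at H b"

definition Pi1 :: "'v pair_pre_digraph \<Rightarrow> 'v \<Rightarrow> 'v list set monoid" where
  "Pi1 H b =
     \<lparr>carrier = loops_at H b // spur_equiv H b,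
      mult = (\<lambda>A B. \<Union>p\<in>A. \<Union>q\<in>B. spur_equiv H b `` {vwalk_join p q}),
      one = spur_equiv H b `` {[b]}\<rparr>"

section \<open>The reduced homotopy group\<close>

definition normal_closure :: "('a, 'm) monoid_scheme \<Rightarrow> 'a set \<Rightarrow> 'a set" where
  "normal_closure G S = \<Inter>{N. N \<lhd> G \<and> S \<subseteq> N}"

text \<open>The walk \<open>l\<close> from \<open>b\<close> puts the closed walk \<open>s\<close> in the component of \<open>b\<close>.\<close>

definition square_classes :: "'v pair_pre_digraph \<Rightarrow> 'v \<Rightarrow> 'v list set set" where
  "square_classes H b =
     {spur_equiv H b `` {vwalk_join (vwalk_join l s) (rev l)} | l s.
        vwalk l (with_proj H) \<and> hd l = b \<and>
        closed_vwalk H s \<and> vwalk_length s = 4 \<and> last l = hd s}"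

definition Pi1_star :: "'v pair_pre_digraph \<Rightarrow> 'v \<Rightarrow> 'v list set set monoid" where
  "Pi1_star H b = Pi1 H b Mod normal_closure (Pi1 H b) (square_classes H b)"

definition Pi1_star_class :: "'v pair_pre_digraph \<Rightarrow> 'v list \<Rightarrow> 'v list set set" where
  "Pi1_star_class H p =
     normal_closure (Pi1 H (hd p)) (square_classes H (hd p)) #>\<^bsub>Pi1 H (hd p)\<^esub>
       (spur_equiv H (hd p) `` {p})"

section \<open>Actions of \<open>\<int>\<^sup>d\<close> on zero-dimensional Polish spaces\<close>

definition Polish_topology :: "'a topology \<Rightarrow> bool" where
  "Polish_topology X \<longleftrightarrow> completely_metrizable_space X \<and> separable_space X"

definition zero_dimensional :: "'a topology \<Rightarrow> bool" where
  "zero_dimensional X \<longleftrightarrow>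
     (\<exists>\<B>. (\<forall>V\<in>\<B>. openin X V \<and> closedin X V) \<and>
          (\<forall>U x. openin X U \<and> x \<in> U \<longrightarrow> (\<exists>V\<in>\<B>. x \<in> V \<and> V \<subseteq> U)))"

text \<open>
  The group \<open>\<int>\<^sup>d\<close> is \<open>int ^ 'd\<close> with \<open>d = CARD('d) \<ge> 1\<close>, and \<open>axis i 1\<close> is its \<open>i\<close>-th standard
  generator.  The values of \<open>act g\<close> outside \<open>topspace X\<close> are irrelevant.
\<close>

definition continuous_action :: "'a topology \<Rightarrow> ('g::group_add \<Rightarrow> 'a \<Rightarrow> 'a) \<Rightarrow> bool" where
  "continuous_action X act \<longleftrightarrow>
     continuous_map (prod_topology (discrete_topology UNIV) X) X (\<lambda>(g, x). act g x) \<and>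
     (\<forall>x\<in>topspace X. act 0 x = x) \<and>
     (\<forall>g h. \<forall>x\<in>topspace X. act (g + h) x = act g (act h x))"

definition free_action :: "'a topology \<Rightarrow> ('g::group_add \<Rightarrow> 'a \<Rightarrow> 'a) \<Rightarrow> bool" where
  "free_action X act \<longleftrightarrow> (\<forall>g. \<forall>x\<in>topspace X. act g x = x \<longrightarrow> g = 0)"

definition schreier_graph :: "'a topology \<Rightarrow> (int ^ 'd \<Rightarrow> 'a \<Rightarrow> 'a) \<Rightarrow> 'a pair_pre_digraph" where
  "schreier_graph X act =
     \<lparr>pverts = topspace X,
      parcs = (\<Union>x\<in>topspace X. \<Union>i. {(x, act (axis i 1) x), (act (axis i 1) x, x)})\<rparr>"

definition continuous_graph_hom ::
    "'a topology \<Rightarrow> 'a pair_pre_digraph \<Rightarrow> 'v pair_pre_digraph \<Rightarrow> ('a \<Rightarrow> 'v) \<Rightarrow> bool" where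
  "continuous_graph_hom X G H c \<longleftrightarrow>
     continuous_map X (discrete_topology (pverts H)) c \<and>
     (\<forall>(x, y)\<in>parcs G. (c x, c y) \<in> parcs H)"

section \<open>The quotients are groups\<close>

lemma loops_at_iff: "p \<in> loops_at H b \<longleftrightarrow> vwalk p (with_proj H) \<and> hd p = b \<and> last p = b"
  by (simp add: loops_at_def)

lemma loops_at_not_Nil: "p \<in> loops_at H b \<Longrightarrow> p \<noteq> []"
  by (auto simp: loops_at_def)

lemma loops_at_join:
  assumes "p \<in> loops_at H b" "q \<in> loops_at H b"
  shows "vwalk_join p q \<in> loops_at H b"
proof -
  have "p \<noteq> []" "q \<noteq> []" "joinable p q"
    using assms by (auto simp: loops_at_def)
  then show ?thesis
    using assms by (simp add: loops_at_iff vwalk_joinI_vwalk vwalk_join_hd vwalk_join_last)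
qed

lemma equiv_spur_equiv: "equiv (loops_at H b) (spur_equiv H b)"
proof -
  let ?r = "spur_insertion H b \<union> (spur_insertion H b)\<inverse>"
  have "sym (?r\<^sup>*)"
    by (rule sym_rtrancl) (rule sym_Un_converse)
  then have "sym (spur_equiv H b)"
    unfolding spur_equiv_def sym_def by blast
  moreover have "trans (spur_equiv H b)"
    unfolding spur_equiv_def by (rule transI) (blast intro: rtrancl_trans)
  moreover have "refl_on (loops_at H b) (spur_equiv H b)" "spur_equiv H b \<subseteq> loops_at H b \<times> loops_at H b"
    by (auto simp: refl_on_def spur_equiv_def)
  ultimately show ?thesis by (simp add: equiv_def)
qed

lemma spur_insertion_equiv: "(p, q) \<in> spur_insertion H b \<Longrightarrow> (p, q) \<in> spur_equiv H b"
  unfolding spur_equiv_def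
  by (intro IntI r_into_rtrancl UnI1) (auto simp: spur_insertion_def)

lemma spur_insertion_join_left:
  assumes "(p, p') \<in> spur_insertion H b" "q \<in> loops_at H b"
  shows "(vwalk_join p q, vwalk_join p' q) \<in> spur_insertion H b"
proof -
  obtain xs u v ys where eq: "p = xs @ [u] @ ys" "p' = xs @ [u, v, u] @ ys"
    and loops: "p \<in> loops_at H b" "p' \<in> loops_at H b"
    using assms by (auto simp: spur_insertion_def)
  have "vwalk_join p q = xs @ [u] @ (ys @ tl q)" "vwalk_join p' q = xs @ [u, v, u] @ (ys @ tl q)"
    using eq by (simp_all add: vwalk_join_def)
  moreover have "vwalk_join p q \<in> loops_at H b" "vwalk_join p' q \<in> loops_at H b"
    using loops assms(2) by (auto intro: loops_at_join)
  ultimately show ?thesis unfolding spur_insertion_def by blast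
qed

lemma spur_insertion_join_right:
  assumes "(q, q') \<in> spur_insertion H b" "p \<in> loops_at H b"
  shows "(vwalk_join p q, vwalk_join p q') \<in> spur_insertion H b"
proof -
  obtain xs u v ys where eq: "q = xs @ [u] @ ys" "q' = xs @ [u, v, u] @ ys"
    and loops: "q \<in> loops_at H b" "q' \<in> loops_at H b"
    using assms by (auto simp: spur_insertion_def)
  have j: "joinable p q" "joinable p q'"
    using loops assms(2) by (auto simp: loops_at_def)
  have "vwalk_join p q = (butlast p @ xs) @ [u] @ ys" "vwalk_join p q' = (butlast p @ xs) @ [u, v, u] @ ys"
    using eq j by (simp_all add: vwalk_join_def2)
  moreover have "vwalk_join p q \<in> loops_at H b" "vwalk_join p q' \<in> loops_at H b"
    using loops assms(2) by (auto intro: loops_at_join)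
  ultimately show ?thesis unfolding spur_insertion_def by blast
qed

lemma spur_equiv_map:
  assumes "\<And>p q. (p, q) \<in> spur_insertion H b \<Longrightarrow> (f p, f q) \<in> spur_insertion H b'"
    and "\<And>p. p \<in> loops_at H b \<Longrightarrow> f p \<in> loops_at H b'"
    and "(p, q) \<in> spur_equiv H b"
  shows "(f p, f q) \<in> spur_equiv H b'"
proof -
  let ?r = "\<lambda>b. spur_insertion H b \<union> (spur_insertion H b)\<inverse>"
  have "(p, q) \<in> (?r b)\<^sup>*" using assms(3) by (simp add: spur_equiv_def)
  then have "(f p, f q) \<in> (?r b')\<^sup>*"
  proof induction
    case (step y z)
    then have "(f y, f z) \<in> ?r b'" using assms(1) by blast
    with step.IH show ?case by (rule rtrancl_into_rtrancl)
  qed simp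
  then show ?thesis using assms(2,3) by (simp add: spur_equiv_def)
qed

lemma spur_equiv_join:
  assumes "(p, p') \<in> spur_equiv H b" "(q, q') \<in> spur_equiv H b"
  shows "(vwalk_join p q, vwalk_join p' q') \<in> spur_equiv H b"
proof -
  have l: "p' \<in> loops_at H b" "q \<in> loops_at H b"
    using assms by (auto simp: spur_equiv_def)
  have "(vwalk_join p q, vwalk_join p' q) \<in> spur_equiv H b"
    by (rule spur_equiv_map[OF _ _ assms(1)])
       (simp_all add: spur_insertion_join_left loops_at_join l)
  moreover have "(vwalk_join p' q, vwalk_join p' q') \<in> spur_equiv H b"
    by (rule spur_equiv_map[OF _ _ assms(2)])
       (simp_all add: spur_insertion_join_right loops_at_join l)
  ultimately show ?thesis
    using equiv_spur_equiv[of H b] by (metis equivE transD)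
qed

lemma Pi1_mult_class:
  assumes "p \<in> loops_at H b" "q \<in> loops_at H b"
  shows "spur_equiv H b `` {p} \<otimes>\<^bsub>Pi1 H b\<^esub> spur_equiv H b `` {q} = spur_equiv H b `` {vwalk_join p q}"
proof -
  have "congruent2 (spur_equiv H b) (spur_equiv H b) (\<lambda>p q. spur_equiv H b `` {vwalk_join p q})"
    by (rule congruent2I')
       (metis equiv_class_eq equiv_spur_equiv spur_equiv_join)
  from UN_equiv_class2[OF equiv_spur_equiv equiv_spur_equiv this assms]
  show ?thesis by (simp add: Pi1_def)
qed

lemma Pi1_carrier_iff:
  "A \<in> carrier (Pi1 H b) \<longleftrightarrow> (\<exists>p\<in>loops_at H b. A = spur_equiv H b `` {p})"
  by (auto simp: Pi1_def quotient_def)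

lemma trivial_loop: "b \<in> pverts H \<Longrightarrow> [b] \<in> loops_at H b"
  by (simp add: loops_at_def)

lemma vwalk_rev:
  assumes "pair_graph H" "vwalk p (with_proj H)"
  shows "vwalk (rev p) (with_proj H)"
proof -
  interpret pair_graph H by fact
  have "sym (parcs H)" using pair_sym_arcs by (simp add: symmetric_def)
  then show ?thesis
    using assms(2) by (auto simp: vwalk_def set_vwalk_arcs_rev dest: symD)
qed

lemma join_rev_loop:
  assumes "pair_graph H" "vwalk p (with_proj H)"
  shows "vwalk_join p (rev p) \<in> loops_at H (hd p)"
proof -
  have "p \<noteq> []" using assms(2) by auto
  then show ?thesis
    using assms vwalk_rev[OF assms]
    by (simp add: loops_at_iff hd_rev last_rev vwalk_joinI_vwalk vwalk_join_hd vwalk_join_last)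
qed

lemma join_rev_trivial:
  assumes "pair_graph H" "vwalk p (with_proj H)"
  shows "(vwalk_join p (rev p), [hd p]) \<in> spur_equiv H (hd p)"
  using assms(2)
proof (induction p rule: rev_induct)
  case (snoc u p)
  show ?case
  proof (cases p rule: rev_cases)
    case Nil
    then show ?thesis using snoc.prems by (simp add: vwalk_join_def spur_equiv_def trivial_loop)
  next
    case (snoc p' w)
    have wp: "vwalk p (with_proj H)"
      using snoc.prems \<open>p = p' @ [w]\<close> vwalkI_append_l[of p "[u]"] by simp
    have hd: "hd (p @ [u]) = hd p" using snoc by (cases p') auto
    have "vwalk_join p (rev p) = p' @ [w] @ rev p'"
      "vwalk_join (p @ [u]) (rev (p @ [u])) = p' @ [w, u, w] @ rev p'"
      using snoc by (simp_all add: vwalk_join_def)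
    then have "(vwalk_join p (rev p), vwalk_join (p @ [u]) (rev (p @ [u]))) \<in> spur_insertion H (hd p)"
      using join_rev_loop[OF assms(1) wp] join_rev_loop[OF assms(1) snoc.prems] hd
      unfolding spur_insertion_def by auto
    then have "(vwalk_join p (rev p), vwalk_join (p @ [u]) (rev (p @ [u]))) \<in> spur_equiv H (hd p)"
      by (rule spur_insertion_equiv)
    then show ?thesis
      using snoc.IH[OF wp] equiv_spur_equiv[of H "hd p"] hd by (metis equivE symD transD)
  qed
qed (auto simp: vwalk_def)

theorem group_Pi1:
  assumes "pair_graph H" "b \<in> pverts H"
  shows "group (Pi1 H b)"
proof (rule groupI)
  let ?c = "\<lambda>p. spur_equiv H b `` {p}"
  have one: "\<one>\<^bsub>Pi1 H b\<^esub> = ?c [b]" by (simp add: Pi1_def)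
  show "\<one>\<^bsub>Pi1 H b\<^esub> \<in> carrier (Pi1 H b)"
    using one trivial_loop[OF assms(2)] by (auto simp: Pi1_carrier_iff)
  fix A assume "A \<in> carrier (Pi1 H b)"
  then obtain p where p: "p \<in> loops_at H b" and A: "A = ?c p" by (auto simp: Pi1_carrier_iff)
  show "\<one>\<^bsub>Pi1 H b\<^esub> \<otimes>\<^bsub>Pi1 H b\<^esub> A = A"
  proof -
    have "p = b # tl p" using p loops_at_not_Nil[OF p] by (metis list.collapse loops_at_iff)
    then have "vwalk_join [b] p = p" by (simp add: vwalk_join_def)
    then show ?thesis using one A Pi1_mult_class[OF trivial_loop[OF assms(2)] p] by simp
  qed
  show "\<exists>B\<in>carrier (Pi1 H b). B \<otimes>\<^bsub>Pi1 H b\<^esub> A = \<one>\<^bsub>Pi1 H b\<^esub>"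
  proof
    have w: "vwalk (rev p) (with_proj H)" using p assms vwalk_rev by (auto simp: loops_at_iff)
    have r: "rev p \<in> loops_at H b"
      using w p loops_at_not_Nil[OF p] by (simp add: loops_at_iff hd_rev last_rev)
    then show "?c (rev p) \<in> carrier (Pi1 H b)" by (auto simp: Pi1_carrier_iff)
    have "(vwalk_join (rev p) p, [b]) \<in> spur_equiv H b"
      using join_rev_trivial[OF assms(1) w] r by (simp add: loops_at_iff)
    then show "?c (rev p) \<otimes>\<^bsub>Pi1 H b\<^esub> A = \<one>\<^bsub>Pi1 H b\<^esub>"
      using one A Pi1_mult_class[OF r p] equiv_class_eq[OF equiv_spur_equiv] by metis
  qed
  fix B assume "B \<in> carrier (Pi1 H b)"
  then obtain q where q: "q \<in> loops_at H b" and B: "B = ?c q" by (auto simp: Pi1_carrier_iff)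
  show "A \<otimes>\<^bsub>Pi1 H b\<^esub> B \<in> carrier (Pi1 H b)"
    using A B Pi1_mult_class[OF p q] loops_at_join[OF p q] by (auto simp: Pi1_carrier_iff)
  fix C assume "C \<in> carrier (Pi1 H b)"
  then obtain r where r: "r \<in> loops_at H b" and C: "C = ?c r" by (auto simp: Pi1_carrier_iff)
  show "A \<otimes>\<^bsub>Pi1 H b\<^esub> B \<otimes>\<^bsub>Pi1 H b\<^esub> C = A \<otimes>\<^bsub>Pi1 H b\<^esub> (B \<otimes>\<^bsub>Pi1 H b\<^esub> C)"
    using A B C p q r loops_at_not_Nil[OF p] loops_at_not_Nil[OF q]
    by (simp add: Pi1_mult_class loops_at_join vwalk_join_assoc')
qed

lemma square_classes_carrier:
  assumes "pair_graph H"
  shows "square_classes H b \<subseteq> carrier (Pi1 H b)"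
proof
  fix A assume "A \<in> square_classes H b"
  then obtain l s where A: "A = spur_equiv H b `` {vwalk_join (vwalk_join l s) (rev l)}"
    and l: "vwalk l (with_proj H)" "hd l = b" and s: "closed_vwalk H s" and ls: "last l = hd s"
    by (auto simp: square_classes_def)
  have ne: "l \<noteq> []" "s \<noteq> []" using l s by (auto simp: closed_vwalk_def)
  have 1: "vwalk (vwalk_join l s) (with_proj H)" "hd (vwalk_join l s) = b"
    "last (vwalk_join l s) = last l"
    using ne l s ls
    by (simp_all add: closed_vwalk_def vwalk_joinI_vwalk vwalk_join_hd vwalk_join_last)
  have "vwalk_join (vwalk_join l s) (rev l) \<in> loops_at H b"
    using 1 ne vwalk_rev[OF assms l(1)] l
    by (simp add: loops_at_iff hd_rev last_rev vwalk_joinI_vwalk vwalk_join_hd vwalk_join_last)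
  then show "A \<in> carrier (Pi1 H b)" using A by (auto simp: Pi1_carrier_iff)
qed

lemma (in group) carrier_normal: "carrier G \<lhd> G"
  by (simp add: normal_inv_iff subgroup_self)

lemma (in group) normal_closure_normal:
  assumes "S \<subseteq> carrier G"
  shows "normal_closure G S \<lhd> G"
proof -
  have ne: "{N. N \<lhd> G \<and> S \<subseteq> N} \<noteq> {}" using carrier_normal assms by blast
  have "subgroup (normal_closure G S) G"
    unfolding normal_closure_def
    by (rule subgroups_Inter) (use ne in \<open>auto intro: normal_imp_subgroup\<close>)
  then show ?thesis
    unfolding normal_inv_iff by (auto simp: normal_closure_def intro: normal.inv_op_closed2)
qed

theorem group_Pi1_star:
  assumes "pair_graph H" "b \<in> pverts H"
  shows "group (Pi1_star H b)"
  unfolding Pi1_star_def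
  by (intro normal.factorgroup_is_group group.normal_closure_normal group_Pi1
      square_classes_carrier assms)

lemma Pi1_star_class_carrier:
  assumes "closed_vwalk H p"
  shows "Pi1_star_class H p \<in> carrier (Pi1_star H (hd p))"
proof -
  have "spur_equiv H (hd p) `` {p} \<in> carrier (Pi1 H (hd p))"
    using assms by (auto simp: Pi1_carrier_iff closed_vwalk_def loops_at_iff)
  then show ?thesis by (simp add: Pi1_star_class_def Pi1_star_def carrier_FactGroup)
qed

end

theory Submission
  imports Defs
begin

text \<open>
  The hypothesis contracts the double of \<open>\<gamma>\<close>, which amounts to a map to \<open>H\<close> from the graph on the
  two-sphere that joins nearly antipodal points.  So it suffices to find \<open>k : X \<rightarrow> S\<^sup>2\<close>, locally
  constant, with \<open>k (e\<^sub>i \<cdot> x)\<close> close to \<open>- k x\<close> for all \<open>i\<close>.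

  Clopen marker sets at a large scale, in a number depending only on \<open>d\<close>, send \<open>x\<close> to a point of the
  join of finitely many copies of \<open>\<int>/M\<close>: the \<open>j\<close>-th weight measures the distance to the nearest
  marker of the \<open>j\<close>-th kind, and the \<open>j\<close>-th coordinate is the height of \<open>x\<close> above this marker
  modulo \<open>M\<close>.  A generator changes the weights slightly and adds 1 to all heights.  What remains is a
  continuous map from the join to \<open>S\<^sup>2\<close> that turns the shift of heights into the antipode.  It is
  built from the maps \<open>(z, w) \<mapsto> (z\<^sup>N - w\<^sup>N, w z\<^sup>*)\<close> between three-spheres.  These are
  equivariant for suitable rotations of order \<open>N\<^sup>2\<close> and \<open>N\<close> but null-homotopic, so that each of them
  lets one add one more copy of \<open>\<int>/M\<close> to the join.
\<close>

section \<open>Walks up to spurs and squares\<close>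

lemma vwalk_append_iff:
  "vwalk (p @ q) G \<longleftrightarrow>
     (if p = [] then vwalk q G else if q = [] then vwalk p G
      else vwalk p G \<and> vwalk q G \<and> (last p, hd q) \<in> arcs_ends G)"
  by (auto simp: vwalk_def vwalk_arcs_append)

lemma vwalk_Cons_Cons_iff:
  "vwalk (u # v # p) G \<longleftrightarrow> u \<in> verts G \<and> (u, v) \<in> arcs_ends G \<and> vwalk (v # p) G"
  by (auto simp: vwalk_def)

lemma vwalk_replace_inner:
  assumes "vwalk (xs @ p @ ys) G" "vwalk p G" "vwalk q G" "hd p = hd q" "last p = last q"
  shows "vwalk (xs @ q @ ys) G"
proof -
  have "p \<noteq> []" "q \<noteq> []" using assms(2,3) by (auto simp: vwalk_def)
  then show ?thesis using assms by (auto simp: vwalk_append_iff split: if_splits)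
qed

text \<open>Up to spurs, exchanging \<open>b\<close> for \<open>b'\<close> inserts the closed walk
  \<open>a, b', c, b, a\<close> of length four. In this form the square relation keeps the length
  and the ends of a walk, so that the stages of a contraction can be compared vertex by
  vertex.\<close>

definition vertex_swap :: "'v pair_pre_digraph \<Rightarrow> 'v list rel" where
  "vertex_swap H = {(p, q). vwalk p (with_proj H) \<and> vwalk q (with_proj H) \<and>
     (\<exists>xs a b b' c ys. p = xs @ [a, b, c] @ ys \<and> q = xs @ [a, b', c] @ ys)}"

text \<open>Unlike in \<open>spur_insertion\<close> no base point is fixed, so that the moves also
  apply to segments of a walk.\<close>

definition spur_move :: "'v pair_pre_digraph \<Rightarrow> 'v list rel" where
  "spur_move H = {(p, q). vwalk p (with_proj H) \<and> vwalk q (with_proj H) \<and>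
     (\<exists>xs u v ys. p = xs @ [u] @ ys \<and> q = xs @ [u, v, u] @ ys)}"

definition walk_homotopic :: "'v pair_pre_digraph \<Rightarrow> 'v list rel" where
  "walk_homotopic H = (vertex_swap H \<union> spur_move H \<union> (spur_move H)\<inverse>)\<^sup>*"

lemma vertex_swapD:
  assumes "(p, q) \<in> vertex_swap H"
  shows "vwalk p (with_proj H)" "vwalk q (with_proj H)" "hd p = hd q" "last p = last q"
    "length p = length q"
  using assms by (auto simp: vertex_swap_def hd_append)

lemma spur_moveD:
  assumes "(p, q) \<in> spur_move H"
  shows "vwalk p (with_proj H)" "vwalk q (with_proj H)" "hd p = hd q" "last p = last q"
  using assms by (auto simp: spur_move_def hd_append)

lemma sym_vertex_swap: "sym (vertex_swap H)"
  unfolding sym_def vertex_swap_def by blast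

lemma vertex_swap_context:
  assumes "(p, q) \<in> vertex_swap H" "vwalk (xs @ p @ ys) (with_proj H)"
  shows "(xs @ p @ ys, xs @ q @ ys) \<in> vertex_swap H"
proof -
  note d = vertex_swapD[OF assms(1)]
  have w: "vwalk (xs @ q @ ys) (with_proj H)"
    using vwalk_replace_inner[OF assms(2) d(1,2,3,4)] .
  obtain us a b b' c vs where "p = us @ [a, b, c] @ vs" "q = us @ [a, b', c] @ vs"
    using assms(1) by (auto simp: vertex_swap_def)
  then have "xs @ p @ ys = (xs @ us) @ [a, b, c] @ (vs @ ys)"
    "xs @ q @ ys = (xs @ us) @ [a, b', c] @ (vs @ ys)" by simp_all
  then show ?thesis using w assms(2) unfolding vertex_swap_def by blast
qed

lemma spur_move_context:
  assumes "(p, q) \<in> spur_move H" "vwalk (xs @ p @ ys) (with_proj H)"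
  shows "(xs @ p @ ys, xs @ q @ ys) \<in> spur_move H"
proof -
  note d = spur_moveD[OF assms(1)]
  have w: "vwalk (xs @ q @ ys) (with_proj H)"
    using vwalk_replace_inner[OF assms(2) d(1,2,3,4)] .
  obtain us u v vs where "p = us @ [u] @ vs" "q = us @ [u, v, u] @ vs"
    using assms(1) by (auto simp: spur_move_def)
  then have "xs @ p @ ys = (xs @ us) @ [u] @ (vs @ ys)"
    "xs @ q @ ys = (xs @ us) @ [u, v, u] @ (vs @ ys)" by simp_all
  then show ?thesis using w assms(2) unfolding spur_move_def by blast
qed

lemma vertex_swaps_context:
  assumes "(p, q) \<in> (vertex_swap H)\<^sup>*" "vwalk (xs @ p @ ys) (with_proj H)"
  shows "(xs @ p @ ys, xs @ q @ ys) \<in> (vertex_swap H)\<^sup>*"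
proof -
  have "(xs @ p @ ys, xs @ q @ ys) \<in> (vertex_swap H)\<^sup>* \<and> vwalk (xs @ q @ ys) (with_proj H)"
    using assms(1)
  proof induction
    case (step y z)
    then have "(xs @ y @ ys, xs @ z @ ys) \<in> vertex_swap H" by (blast intro: vertex_swap_context)
    then show ?case using step.IH vertex_swapD(2) by (blast intro: rtrancl_into_rtrancl)
  qed (use assms(2) in simp)
  then show ?thesis by simp
qed

lemma walk_move_context:
  assumes "(p, q) \<in> vertex_swap H \<union> spur_move H \<union> (spur_move H)\<inverse>"
    "vwalk (xs @ p @ ys) (with_proj H)"
  shows "(xs @ p @ ys, xs @ q @ ys) \<in> vertex_swap H \<union> spur_move H \<union> (spur_move H)\<inverse>"
    "vwalk (xs @ q @ ys) (with_proj H)"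
proof -
  show w: "vwalk (xs @ q @ ys) (with_proj H)"
    using assms vwalk_replace_inner[OF assms(2), of q] vertex_swapD[of p q H] spur_moveD[of p q H]
      spur_moveD[of q p H] by auto
  show "(xs @ p @ ys, xs @ q @ ys) \<in> vertex_swap H \<union> spur_move H \<union> (spur_move H)\<inverse>"
    using assms(1) vertex_swap_context[of p q H xs ys] spur_move_context[of p q H xs ys]
      spur_move_context[of q p H xs ys] w assms(2) by blast
qed

lemma walk_homotopic_context:
  assumes "(p, q) \<in> walk_homotopic H" "vwalk (xs @ p @ ys) (with_proj H)"
  shows "(xs @ p @ ys, xs @ q @ ys) \<in> walk_homotopic H"
proof -
  have "(xs @ p @ ys, xs @ q @ ys) \<in> walk_homotopic H \<and> vwalk (xs @ q @ ys) (with_proj H)"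
    using assms(1) unfolding walk_homotopic_def
  proof induction
    case (step y z)
    then show ?case using walk_move_context[OF step.hyps(2)] by (blast intro: rtrancl_into_rtrancl)
  qed (use assms(2) in simp)
  then show ?thesis by simp
qed

lemma sym_walk_homotopic: "sym (walk_homotopic H)"
  unfolding walk_homotopic_def
  by (rule sym_rtrancl) (use sym_vertex_swap in \<open>auto simp: sym_def\<close>)

lemma trans_walk_homotopic: "trans (walk_homotopic H)"
  unfolding walk_homotopic_def by (rule trans_rtrancl)

lemma walk_homotopic_refl [simp]: "(p, p) \<in> walk_homotopic H"
  by (simp add: walk_homotopic_def)

lemma spur_equiv_walk_homotopic:
  assumes "(p, q) \<in> spur_equiv H b"
  shows "(p, q) \<in> walk_homotopic H"
proof -
  have "spur_insertion H b \<subseteq> spur_move H"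
    unfolding spur_insertion_def spur_move_def loops_at_def by blast
  then have "spur_insertion H b \<union> (spur_insertion H b)\<inverse>
      \<subseteq> vertex_swap H \<union> spur_move H \<union> (spur_move H)\<inverse>" by blast
  then show ?thesis
    using assms rtrancl_mono unfolding spur_equiv_def walk_homotopic_def by blast
qed

lemma walk_homotopic_join:
  assumes "(p, p') \<in> walk_homotopic H" "(q, q') \<in> walk_homotopic H"
    and "p \<in> loops_at H b" "p' \<in> loops_at H b" "q \<in> loops_at H b" "q' \<in> loops_at H b"
  shows "(vwalk_join p q, vwalk_join p' q') \<in> walk_homotopic H"
proof -
  have "vwalk (p @ tl q) (with_proj H)"
    using loops_at_join[OF assms(3,5)] by (simp add: loops_at_iff vwalk_join_def)
  then have 1: "(p @ tl q, p' @ tl q) \<in> walk_homotopic H"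
    using walk_homotopic_context[OF assms(1), of "[]" "tl q"] by simp
  have j: "joinable p' q" "joinable p' q'"
    using assms(3-6) by (auto simp: loops_at_def joinable_def)
  have "vwalk (butlast p' @ q) (with_proj H)"
    using loops_at_join[OF assms(4,5)] j by (simp add: loops_at_iff vwalk_join_def2)
  then have "(butlast p' @ q, butlast p' @ q') \<in> walk_homotopic H"
    using walk_homotopic_context[OF assms(2), of "butlast p'" "[]"] by simp
  then have 2: "(vwalk_join p' q, vwalk_join p' q') \<in> walk_homotopic H"
    using j by (simp add: vwalk_join_def2)
  show ?thesis using 1 2 trans_walk_homotopic[of H] by (auto simp: vwalk_join_def dest: transD)
qed

section \<open>Contractible loops as a normal subgroup\<close>

lemma rev_loop:
  assumes "pair_graph H" "p \<in> loops_at H b"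
  shows "rev p \<in> loops_at H b"
  using assms vwalk_rev[of H p] loops_at_not_Nil[OF assms(2)]
  by (auto simp: loops_at_iff hd_rev last_rev)

lemma Pi1_inv_class:
  assumes "pair_graph H" "b \<in> pverts H" "p \<in> loops_at H b"
  shows "inv\<^bsub>Pi1 H b\<^esub> (spur_equiv H b `` {p}) = spur_equiv H b `` {rev p}"
proof (rule group.inv_equality[OF group_Pi1[OF assms(1,2)]])
  note r = rev_loop[OF assms(1,3)]
  have "(vwalk_join (rev p) p, [b]) \<in> spur_equiv H b"
    using join_rev_trivial[OF assms(1), of "rev p"] r by (simp add: loops_at_iff)
  then show "spur_equiv H b `` {rev p} \<otimes>\<^bsub>Pi1 H b\<^esub> spur_equiv H b `` {p} = \<one>\<^bsub>Pi1 H b\<^esub>"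
    using Pi1_mult_class[OF r assms(3)] equiv_class_eq[OF equiv_spur_equiv]
    by (metis Pi1_def monoid.select_convs(2))
qed (use assms rev_loop[OF assms(1,3)] in \<open>auto simp: Pi1_carrier_iff\<close>)

text \<open>An explicit upper bound for the normal closure: this set is a normal subgroup containing
  the squares, hence contains their closure, and each of its elements comes with a chain of moves
  that contracts it.\<close>

definition contractible_classes :: "'v pair_pre_digraph \<Rightarrow> 'v \<Rightarrow> 'v list set set" where
  "contractible_classes H b =
     {spur_equiv H b `` {p} | p. p \<in> loops_at H b \<and> (p, [b]) \<in> walk_homotopic H}"

lemma contractible_classes_iff:
  assumes "p \<in> loops_at H b"
  shows "spur_equiv H b `` {p} \<in> contractible_classes H b \<longleftrightarrow> (p, [b]) \<in> walk_homotopic H"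
proof
  assume "spur_equiv H b `` {p} \<in> contractible_classes H b"
  then obtain q where "q \<in> loops_at H b" "(q, [b]) \<in> walk_homotopic H"
    "spur_equiv H b `` {p} = spur_equiv H b `` {q}"
    by (auto simp: contractible_classes_def)
  then show "(p, [b]) \<in> walk_homotopic H"
    using eq_equiv_class_iff[OF equiv_spur_equiv assms] spur_equiv_walk_homotopic[of p q H b]
      trans_walk_homotopic[of H] by (auto dest: transD)
qed (use assms in \<open>auto simp: contractible_classes_def\<close>)

lemma vwalk_join_singleton [simp]: "vwalk_join [b] p = b # tl p" "p \<noteq> [] \<Longrightarrow> vwalk_join p [b] = p"
  by (simp_all add: vwalk_join_def)

lemma contractible_classes_normal:
  assumes "pair_graph H" "b \<in> pverts H"
  shows "contractible_classes H b \<lhd> Pi1 H b"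
proof -
  let ?G = "Pi1 H b" and ?K = "contractible_classes H b" and ?c = "\<lambda>p. spur_equiv H b `` {p}"
  interpret group ?G by (rule group_Pi1[OF assms])
  note tr = trans_walk_homotopic[of H] and sy = sym_walk_homotopic[of H]
  note b = trivial_loop[OF assms(2)]
  have Nil: "vwalk_join [b] p = p" if "p \<in> loops_at H b" for p
    using that loops_at_not_Nil[OF that] by (cases p) (auto simp: loops_at_iff)
  have rev: "(vwalk_join p (rev p), [b]) \<in> walk_homotopic H" if "p \<in> loops_at H b" for p
    using join_rev_trivial[OF assms(1), of p] that spur_equiv_walk_homotopic
    by (auto simp: loops_at_iff)
  have sub: "subgroup ?K ?G"
  proof (rule subgroupI)
    show "?K \<subseteq> carrier ?G" by (auto simp: contractible_classes_def Pi1_carrier_iff)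
    show "?K \<noteq> {}" using contractible_classes_iff[OF b] by auto
    fix A assume "A \<in> ?K"
    then obtain p where p: "A = ?c p" "p \<in> loops_at H b" "(p, [b]) \<in> walk_homotopic H"
      by (auto simp: contractible_classes_def)
    note rp = rev_loop[OF assms(1) p(2)]
    have "(vwalk_join p (rev p), vwalk_join [b] (rev p)) \<in> walk_homotopic H"
      by (rule walk_homotopic_join[OF p(3) _ p(2) b rp rp]) simp
    then have "(rev p, [b]) \<in> walk_homotopic H"
      using rev[OF p(2)] Nil[OF rp] tr sy by (metis symD transD)
    then show "inv\<^bsub>?G\<^esub> A \<in> ?K"
      using p Pi1_inv_class[OF assms p(2)] contractible_classes_iff[OF rp] by simp
    fix B assume "B \<in> ?K"
    then obtain q where q: "B = ?c q" "q \<in> loops_at H b" "(q, [b]) \<in> walk_homotopic H"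
      by (auto simp: contractible_classes_def)
    have "(vwalk_join p q, vwalk_join [b] [b]) \<in> walk_homotopic H"
      by (rule walk_homotopic_join[OF p(3) q(3) p(2) b q(2) b])
    then show "A \<otimes>\<^bsub>?G\<^esub> B \<in> ?K"
      using p q Pi1_mult_class[OF p(2) q(2)] contractible_classes_iff[OF loops_at_join[OF p(2) q(2)]]
      by simp
  qed
  show ?thesis
    unfolding normal_inv_iff
  proof (intro conjI sub ballI)
    fix A B assume "A \<in> carrier ?G" "B \<in> ?K"
    then obtain p q where p: "A = ?c p" "p \<in> loops_at H b"
      and q: "B = ?c q" "q \<in> loops_at H b" "(q, [b]) \<in> walk_homotopic H"
      by (auto simp: contractible_classes_def Pi1_carrier_iff)
    note rp = rev_loop[OF assms(1) p(2)]
    note pq = loops_at_join[OF p(2) q(2)]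
    have "(vwalk_join p q, vwalk_join p [b]) \<in> walk_homotopic H"
      by (rule walk_homotopic_join[OF _ q(3) p(2) p(2) q(2) b]) simp
    then have "(vwalk_join p q, p) \<in> walk_homotopic H"
      using loops_at_not_Nil[OF p(2)] by simp
    then have "(vwalk_join (vwalk_join p q) (rev p), vwalk_join p (rev p)) \<in> walk_homotopic H"
      by (rule walk_homotopic_join[OF _ _ pq p(2) rp rp]) simp
    then have "(vwalk_join (vwalk_join p q) (rev p), [b]) \<in> walk_homotopic H"
      using rev[OF p(2)] tr by (metis transD)
    then show "A \<otimes>\<^bsub>?G\<^esub> B \<otimes>\<^bsub>?G\<^esub> inv\<^bsub>?G\<^esub> A \<in> ?K"
      using p q Pi1_inv_class[OF assms p(2)] Pi1_mult_class[OF p(2) q(2)] Pi1_mult_class[OF pq rp]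
        contractible_classes_iff[OF loops_at_join[OF pq rp]] by simp
  qed
qed

text \<open>Swapping the fourth vertex \<open>y\<close> for \<open>x\<close> turns the square into
  \<open>a, x, c, x, a\<close>, which two spur deletions reduce to \<open>[a]\<close>.\<close>

lemma closed_4_walk_contractible:
  assumes "pair_graph H" "closed_vwalk H s" "vwalk_length s = 4"
  shows "(s, [hd s]) \<in> walk_homotopic H"
proof -
  interpret pair_graph H by fact
  have "length s = Suc (Suc (Suc (Suc (Suc 0))))" using assms(3) by simp
  then obtain a x c y a' where s: "s = [a, x, c, y, a']" by (auto simp: length_Suc_conv)
  have a': "a' = a" using assms(2) s by (simp add: closed_vwalk_def)
  have w: "vwalk [a, x, c, y, a] (with_proj H)" using assms(2) s a' by (simp add: closed_vwalk_def)
  have "sym (parcs H)" using pair_sym_arcs by (simp add: symmetric_def)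
  then have w': "vwalk [a, x, c, x, a] (with_proj H)"
    using w by (auto simp: vwalk_Cons_Cons_iff dest: symD)
  then have w'': "vwalk [a, x, a] (with_proj H)" and wa: "vwalk [a] (with_proj H)"
    using w by (auto simp: vwalk_Cons_Cons_iff vwalk_def)
  have "([a, x] @ [c, y, a] @ [], [a, x] @ [c, x, a] @ []) \<in> vertex_swap H"
    unfolding vertex_swap_def using w w' by (auto intro!: exI[of _ "[a, x]"])
  then have 1: "(s, [a, x, c, x, a]) \<in> walk_homotopic H"
    unfolding walk_homotopic_def s a' by auto
  have "([a] @ [x] @ [a], [a] @ [x, c, x] @ [a]) \<in> spur_move H"
    unfolding spur_move_def using w' w'' by (auto intro!: exI[of _ "[a]"])
  then have 2: "([a, x, c, x, a], [a, x, a]) \<in> walk_homotopic H"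
    unfolding walk_homotopic_def by auto
  have "([] @ [a] @ [], [] @ [a, x, a] @ []) \<in> spur_move H"
    unfolding spur_move_def using wa w'' by (auto intro!: exI[of _ "[]"])
  then have 3: "([a, x, a], [a]) \<in> walk_homotopic H"
    unfolding walk_homotopic_def by auto
  show ?thesis using 1 2 3 trans_walk_homotopic[of H] s by (auto dest: transD)
qed

text \<open>Once the square is contracted in place, the tail \<open>l\<close> cancels against its
  reverse.\<close>

lemma square_classes_contractible:
  assumes "pair_graph H"
  shows "square_classes H b \<subseteq> contractible_classes H b"
proof
  fix A assume "A \<in> square_classes H b"
  then obtain l s where A: "A = spur_equiv H b `` {vwalk_join (vwalk_join l s) (rev l)}"
    and l: "vwalk l (with_proj H)" "hd l = b" and s: "closed_vwalk H s" "vwalk_length s = 4"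
    and ls: "last l = hd s"
    by (auto simp: square_classes_def)
  have ne: "l \<noteq> []" "s \<noteq> []" using l s by (auto simp: closed_vwalk_def)
  have j: "joinable l s" using ne ls by (simp add: joinable_def)
  have w: "vwalk (vwalk_join l s) (with_proj H)" "last (vwalk_join l s) = last l"
    "hd (vwalk_join l s) = b"
    using ne l s ls
    by (simp_all add: closed_vwalk_def vwalk_joinI_vwalk vwalk_join_hd vwalk_join_last)
  have loop: "vwalk_join (vwalk_join l s) (rev l) \<in> loops_at H b"
    using w ne vwalk_rev[OF assms l(1)] l
    by (simp add: loops_at_iff hd_rev last_rev vwalk_joinI_vwalk vwalk_join_hd vwalk_join_last)
  have eq: "vwalk_join (vwalk_join l s) (rev l) = butlast l @ s @ tl (rev l)"
    using j by (simp add: vwalk_join_def2[of l s]) (simp add: vwalk_join_def)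
  have "(butlast l @ s @ tl (rev l), butlast l @ [hd s] @ tl (rev l)) \<in> walk_homotopic H"
    using walk_homotopic_context[OF closed_4_walk_contractible[OF assms s], of "butlast l" "tl (rev l)"]
      loop eq by (simp add: loops_at_iff)
  moreover have "butlast l @ [hd s] @ tl (rev l) = vwalk_join l (rev l)"
    using ne ls by (simp add: vwalk_join_def append_butlast_last_id[symmetric])
       (metis append_Cons append_Nil append_assoc append_butlast_last_id)
  ultimately have "(vwalk_join (vwalk_join l s) (rev l), vwalk_join l (rev l)) \<in> walk_homotopic H"
    using eq by simp
  moreover have "(vwalk_join l (rev l), [b]) \<in> walk_homotopic H"
    using join_rev_trivial[OF assms l(1)] l(2) spur_equiv_walk_homotopic by auto
  ultimately have "(vwalk_join (vwalk_join l s) (rev l), [b]) \<in> walk_homotopic H"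
    using trans_walk_homotopic[of H] by (auto dest: transD)
  then show "A \<in> contractible_classes H b"
    using A contractible_classes_iff[OF loop] by simp
qed

text \<open>Here the group hypothesis becomes a statement on walks: \<open>C \<otimes> C\<close>
  lies in the normal closure of the squares, which is the least normal subgroup containing them and
  so consists of contractible classes.\<close>

lemma squared_class_trivial_imp_contractible:
  assumes "pair_graph H" "closed_vwalk H \<gamma>"
    and "Pi1_star_class H \<gamma> [^]\<^bsub>Pi1_star H (hd \<gamma>)\<^esub> (2::nat) = \<one>\<^bsub>Pi1_star H (hd \<gamma>)\<^esub>"
  shows "(vwalk_join \<gamma> \<gamma>, [hd \<gamma>]) \<in> walk_homotopic H"
proof -
  define b where "b = hd \<gamma>"
  define G where "G = Pi1 H b"
  define N where "N = normal_closure G (square_classes H b)"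
  define C where "C = spur_equiv H b `` {\<gamma>}"
  have loop: "\<gamma> \<in> loops_at H b" and b: "b \<in> pverts H"
    using assms(2) hd_in_set[of \<gamma>] by (auto simp: closed_vwalk_def loops_at_iff b_def vwalk_def)
  interpret group G unfolding G_def by (rule group_Pi1[OF assms(1) b])
  have "N \<lhd> G"
    unfolding N_def by (rule normal_closure_normal)
      (use square_classes_carrier[OF assms(1)] in \<open>simp add: G_def\<close>)
  then interpret normal N G .
  have C: "C \<in> carrier G" using loop by (auto simp: C_def G_def Pi1_carrier_iff)
  interpret Q: group "G Mod N" by (rule factorgroup_is_group)
  have "N #>\<^bsub>G\<^esub> C \<in> carrier (G Mod N)"
    using C by (auto simp: carrier_FactGroup)
  moreover have "(N #>\<^bsub>G\<^esub> C) [^]\<^bsub>G Mod N\<^esub> (2::nat) = \<one>\<^bsub>G Mod N\<^esub>"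
    using assms(3) by (simp add: Pi1_star_class_def Pi1_star_def b_def G_def N_def C_def)
  ultimately have "(N #>\<^bsub>G\<^esub> C) \<otimes>\<^bsub>G Mod N\<^esub> (N #>\<^bsub>G\<^esub> C) = \<one>\<^bsub>G Mod N\<^esub>"
    by (simp only: numeral_2_eq_2 Q.nat_pow_Suc Q.nat_pow_0 Q.l_one)
  then have "N #>\<^bsub>G\<^esub> (C \<otimes>\<^bsub>G\<^esub> C) = N"
    using C by (simp add: rcos_sum FactGroup_def)
  moreover have "C \<otimes>\<^bsub>G\<^esub> C \<in> carrier G" using C by (rule monoid.m_closed[OF monoid_axioms]) (rule C)
  ultimately have "C \<otimes>\<^bsub>G\<^esub> C \<in> N"
    using rcos_self[OF _ subgroup_axioms] by metis
  moreover have "N \<subseteq> contractible_classes H b"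
    using contractible_classes_normal[OF assms(1) b] square_classes_contractible[OF assms(1)]
    unfolding N_def normal_closure_def G_def by blast
  ultimately show ?thesis
    using Pi1_mult_class[OF loop loop] contractible_classes_iff[OF loops_at_join[OF loop loop]]
    by (auto simp: C_def G_def b_def)
qed

section \<open>Padding by spurs and contractions of fixed length\<close>

lemma pair_graph_arcs_sym:
  assumes "pair_graph H" "(u, v) \<in> parcs H"
  shows "(v, u) \<in> parcs H"
proof -
  interpret pair_graph H by fact
  have "sym (parcs H)" using pair_sym_arcs by (simp add: symmetric_def)
  then show ?thesis using assms(2) by (rule symD)
qed

lemma pair_graph_arc_verts:
  assumes "pair_graph H" "(u, v) \<in> parcs H"
  shows "u \<in> pverts H" "v \<in> pverts H"
proof -
  interpret pair_graph H by fact
  show "u \<in> pverts H" "v \<in> pverts H"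
    using in_arcsD1[OF assms(2)] in_arcsD2[OF assms(2)] by simp_all
qed

lemma vwalk_nth_Suc:
  assumes "vwalk p (with_proj H)" "Suc n < length p"
  shows "(p ! n, p ! Suc n) \<in> parcs H"
  using assms
proof (induction p arbitrary: n rule: vwalk_induct)
  case (Cons u v es)
  then show ?case by (cases n) auto
qed simp

text \<open>The detours \<open>b, e, b\<close>, repeated \<open>k\<close> times and written without
  the initial \<open>b\<close>, so that they can be appended to any walk ending at
  \<open>b\<close>.\<close>

definition spurs :: "'v \<Rightarrow> 'v \<Rightarrow> nat \<Rightarrow> 'v list" where
  "spurs b e k = concat (replicate k [e, b])"

lemma spurs_simps [simp]: "spurs b e 0 = []" "spurs b e (Suc k) = [e, b] @ spurs b e k"
  by (simp_all add: spurs_def)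

lemma spurs_add: "spurs b e (k + l) = spurs b e k @ spurs b e l"
  by (induction k) auto

lemma length_spurs [simp]: "length (spurs b e k) = 2 * k"
  by (induction k) auto

lemma last_append_spurs [simp]: "last p = b \<Longrightarrow> last (p @ spurs b e k) = b"
  by (induction k arbitrary: p) (auto simp del: append_assoc simp: append_assoc[symmetric])

lemma nth_Cons_spurs: "n \<le> 2 * k \<Longrightarrow> (b # spurs b e k) ! n = (if even n then b else e)"
proof (induction k arbitrary: n)
  case (Suc k)
  consider "n = 0" | "n = 1" | m where "n = Suc (Suc m)" by (metis One_nat_def not0_implies_Suc)
  then show ?case using Suc by cases auto
qed simp

lemma vwalk_append_spurs:
  assumes "pair_graph H" "vwalk p (with_proj H)" "last p = b" "(b, e) \<in> parcs H"
  shows "vwalk (p @ spurs b e k) (with_proj H)"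
  using assms(2,3)
proof (induction k arbitrary: p)
  case (Suc k)
  have v: "e \<in> pverts H" "b \<in> pverts H" "(e, b) \<in> parcs H"
    using pair_graph_arc_verts[OF assms(1,4)] pair_graph_arcs_sym[OF assms(1,4)] by auto
  then have "vwalk [e, b] (with_proj H)" by (auto simp: vwalk_def)
  then have "vwalk (p @ [e, b]) (with_proj H)"
    using Suc.prems assms(4) by (auto simp: vwalk_append_iff)
  from Suc.IH[OF this] show ?case by simp
qed simp

text \<open>A spur travels along the walk by swaps alone: in \<open>u, v, u, w\<close> the tip
  \<open>v\<close> is exchanged for the next vertex \<open>w\<close>, and \<open>u, w, u, w\<close>
  contains the spur \<open>w, u, w\<close> one step further on. At the end the tip is exchanged for
  \<open>e\<close>.\<close>

lemma spur_slide:
  assumes H: "pair_graph H"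
    and "vwalk (u # v # u # ys) (with_proj H)" "(last (u # ys), e) \<in> parcs H"
  shows "(u # v # u # ys, u # ys @ [e, last (u # ys)]) \<in> (vertex_swap H)\<^sup>*"
  using assms(2,3)
proof (induction ys arbitrary: u v)
  case Nil
  then have "vwalk [u, e, u] (with_proj H)"
    using pair_graph_arcs_sym[OF H, of u e] vwalk_append_spurs[OF H, of "[u]" u e 1]
    by (auto simp: vwalk_def)
  then have "([u, v, u], [u, e, u]) \<in> vertex_swap H"
    using Nil unfolding vertex_swap_def by (auto intro!: exI[of _ "[]"])
  then show ?case by auto
next
  case (Cons w zs)
  have w: "vwalk (u # w # u # w # zs) (with_proj H)"
    using Cons.prems(1) pair_graph_arcs_sym[OF H, of u w]
    by (auto simp: vwalk_Cons_Cons_iff vwalk_def)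
  then have "(u # v # u # w # zs, u # w # u # w # zs) \<in> vertex_swap H"
    using Cons.prems(1) unfolding vertex_swap_def by (auto intro!: exI[of _ "[]"])
  moreover have "(w # u # w # zs, w # zs @ [e, last (w # zs)]) \<in> (vertex_swap H)\<^sup>*"
    using Cons.IH[of w u] Cons.prems(2) w by (simp add: vwalk_Cons_Cons_iff)
  from vertex_swaps_context[OF this, of "[u]" "[]"] w
  have "(u # w # u # w # zs, u # w # zs @ [e, last (w # zs)]) \<in> (vertex_swap H)\<^sup>*" by simp
  ultimately show ?case by (simp add: converse_rtrancl_into_rtrancl)
qed

lemma spur_move_vertex_swaps:
  assumes "pair_graph H" "(p, q) \<in> spur_move H" "last p = b" "(b, e) \<in> parcs H"
  shows "(q, p @ spurs b e 1) \<in> (vertex_swap H)\<^sup>*"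
proof -
  obtain xs u v ys where pq: "p = xs @ [u] @ ys" "q = xs @ [u, v, u] @ ys"
    and w: "vwalk q (with_proj H)"
    using assms(2) by (auto simp: spur_move_def)
  have w': "vwalk (u # v # u # ys) (with_proj H)"
    using w pq by (auto simp: vwalk_append_iff split: if_splits)
  have l: "last (u # ys) = b" using assms(3) pq by simp
  from vertex_swaps_context[OF spur_slide[OF assms(1) w'], of e xs "[]"] show ?thesis
    using w l assms(4) pq by simp
qed

text \<open>Each inner detour arises by a spur move and can therefore be pushed to the end. This
  serves to redistribute padding between the two copies of a doubled walk.\<close>

lemma spurs_slide:
  assumes "pair_graph H" "vwalk (p @ r) (with_proj H)" "p \<noteq> []" "last p = b" "last (p @ r) = b"
    "(b, e) \<in> parcs H"
  shows "(p @ spurs b e k @ r, p @ r @ spurs b e k) \<in> (vertex_swap H)\<^sup>*"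
proof (induction k)
  case (Suc k)
  let ?S = "spurs b e k"
  obtain xs where xs: "p = xs @ [b]" using assms(3,4) by (metis append_butlast_last_id)
  have wp: "vwalk p (with_proj H)" using assms(2,3) by (auto simp: vwalk_append_iff split: if_splits)
  have "vwalk (p @ spurs b e l @ r) (with_proj H)" for l
    using vwalk_append_spurs[OF assms(1) wp assms(4,6), of l] assms
      last_append_spurs[OF assms(4), of e l]
    by (cases "r = []") (auto simp: vwalk_append_iff simp flip: append_assoc)
  from this[of k] this[of "Suc k"] have "(p @ ?S @ r, p @ spurs b e (Suc k) @ r) \<in> spur_move H"
    unfolding spur_move_def xs by auto
  moreover have "last (p @ ?S @ r) = b"
    using assms(5) last_append_spurs[OF assms(4), of e k] by (cases "r = []") auto
  ultimately have "(p @ spurs b e (Suc k) @ r, (p @ ?S @ r) @ spurs b e 1) \<in> (vertex_swap H)\<^sup>*"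
    using spur_move_vertex_swaps[OF assms(1)] assms(6) by blast
  moreover have "((p @ ?S @ r) @ spurs b e 1, (p @ r @ ?S) @ spurs b e 1) \<in> (vertex_swap H)\<^sup>*"
    using vertex_swaps_context[OF Suc, of "[]" "spurs b e 1"]
      vwalk_append_spurs[OF assms(1) _ \<open>last (p @ ?S @ r) = b\<close> assms(6), of 1]
      \<open>(p @ ?S @ r, p @ spurs b e (Suc k) @ r) \<in> spur_move H\<close>
    by (auto simp: spur_move_def)
  moreover have "?S @ spurs b e 1 = spurs b e (Suc k)"
    using spurs_add[of b e k 1] by simp
  ultimately show ?case by (metis (no_types, lifting) append_assoc rtrancl_trans)
qed simp

text \<open>Padding pays for all changes of length: inserting a spur consumes an appended detour,
  deleting one leaves a detour behind. What remains are swaps between walks of one length.\<close>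

lemma walk_homotopic_vertex_swaps:
  assumes "pair_graph H" "(p, q) \<in> walk_homotopic H" "vwalk p (with_proj H)" "last p = b"
    "(b, e) \<in> parcs H"
  shows "\<exists>k l. (p @ spurs b e k, q @ spurs b e l) \<in> (vertex_swap H)\<^sup>*"
proof -
  have "vwalk q (with_proj H) \<and> last q = b \<and>
      (\<exists>k l. (p @ spurs b e k, q @ spurs b e l) \<in> (vertex_swap H)\<^sup>*)"
    using assms(2) unfolding walk_homotopic_def
  proof induction
    case base
    then show ?case using assms(3,4) by (auto intro!: exI[of _ 0])
  next
    case (step y z)
    then obtain k l where kl: "(p @ spurs b e k, y @ spurs b e l) \<in> (vertex_swap H)\<^sup>*"
      and y: "vwalk y (with_proj H)" "last y = b" by blast
    note ctx = vertex_swaps_context[of _ _ H "[]", simplified]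
    have pad: "vwalk (x @ spurs b e j) (with_proj H)" if "vwalk x (with_proj H)" "last x = b" for x j
      using vwalk_append_spurs[OF assms(1) that assms(5)] .
    \<comment> \<open>The chain so far also runs with one more detour appended, which an insertion
      then uses up.\<close>
    have kl': "(p @ spurs b e (k + 1), y @ spurs b e (l + 1)) \<in> (vertex_swap H)\<^sup>*"
      using ctx[OF kl, of "spurs b e 1"] pad[OF assms(3,4), of "k + 1"] unfolding spurs_add by simp
    from step.hyps(2) consider "(y, z) \<in> vertex_swap H" | "(y, z) \<in> spur_move H"
      | "(z, y) \<in> spur_move H" by blast
    then show ?case
    proof cases
      case 1
      have "(y @ spurs b e l, z @ spurs b e l) \<in> vertex_swap H"
        using vertex_swap_context[OF 1, of "[]" "spurs b e l"] pad[OF y] by simp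
      then show ?thesis
        using kl vertex_swapD[OF 1] y by (metis rtrancl_into_rtrancl)
    next
      case 2
      note z = spur_moveD[OF 2]
      have "(z @ spurs b e l, (y @ spurs b e 1) @ spurs b e l) \<in> (vertex_swap H)\<^sup>*"
        using ctx[OF spur_move_vertex_swaps[OF assms(1) 2 y(2) assms(5)]] pad z y by simp
      then have "((y @ spurs b e 1) @ spurs b e l, z @ spurs b e l) \<in> (vertex_swap H)\<^sup>*"
        using sym_rtrancl[OF sym_vertex_swap, of H] by (meson symD)
      moreover have "(y @ spurs b e 1) @ spurs b e l = y @ spurs b e (l + 1)"
        using spurs_add[of b e 1 l] by (simp add: add.commute)
      ultimately show ?thesis using kl' z y by (metis rtrancl_trans)
    next
      case 3
      note z = spur_moveD[OF 3]
      have "(y @ spurs b e l, (z @ spurs b e 1) @ spurs b e l) \<in> (vertex_swap H)\<^sup>*"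
        using ctx[OF spur_move_vertex_swaps[OF assms(1) 3 _ assms(5)]] pad z y by simp
      moreover have "(z @ spurs b e 1) @ spurs b e l = z @ spurs b e (l + 1)"
        using spurs_add[of b e 1 l] by (simp add: add.commute)
      ultimately show ?thesis using kl z y by (metis rtrancl_trans)
    qed
  qed
  then show ?thesis by blast
qed

text \<open>A closed walk with \<open>L + 1\<close> entries becomes an \<open>L\<close>-periodic
  function; its last entry, which repeats the first, is never read.\<close>

definition cyclic_nth :: "nat \<Rightarrow> 'a list \<Rightarrow> int \<Rightarrow> 'a" where
  "cyclic_nth L w i = w ! nat (i mod int L)"

text \<open>A swap changes a single inner entry. Of two consecutive positions, the first read in
  \<open>w\<close> and the second in \<open>w'\<close>, the pair is an arc of \<open>w'\<close> if
  the second is the changed one, and an arc of \<open>w\<close> otherwise.\<close>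

lemma cyclic_nth_step:
  assumes "(w, w') \<in> (vertex_swap H)\<^sup>=" "vwalk w (with_proj H)" "length w = Suc L" "L > 0"
    "hd w = last w"
  shows "(cyclic_nth L w i, cyclic_nth L w' (i + 1)) \<in> parcs H"
proof -
  have w': "vwalk w' (with_proj H)" "length w' = Suc L" "hd w' = last w'"
    using assms vertex_swapD[of w w' H] by auto
  have ends: "w' ! L = w' ! 0"
    using w' by (metis Zero_not_Suc diff_Suc_1 hd_conv_nth last_conv_nth list.size(3))
  define n where "n = nat (i mod int L)"
  have n: "n < L" "int n = i mod int L" using assms(4) by (auto simp: n_def nat_less_iff)
  have arc: "(w ! n, w' ! Suc n) \<in> parcs H"
  proof (cases "w = w'")
    case True
    then show ?thesis using vwalk_nth_Suc[OF assms(2)] n assms(3) by simp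
  next
    case False
    with assms(1) have "(w, w') \<in> vertex_swap H" by simp
    then obtain xs a b b' c ys where eq: "w = xs @ [a, b, c] @ ys" "w' = xs @ [a, b', c] @ ys"
      unfolding vertex_swap_def by blast
    show ?thesis
    proof (cases "n = length xs")
      case True
      then have "w ! n = w' ! n" using eq by simp
      then show ?thesis using vwalk_nth_Suc[OF w'(1), of n] n w'(2) by simp
    next
      case False
      then have "w' ! Suc n = w ! Suc n"
        using eq by (auto simp: nth_append nth_Cons split: nat.splits)
      then show ?thesis using vwalk_nth_Suc[OF assms(2), of n] n assms(3) by simp
    qed
  qed
  have "(i + 1) mod int L = int (Suc n mod L)"
    using n(2) by (simp add: zmod_int mod_simps add.commute)
  then have "w' ! nat ((i + 1) mod int L) = w' ! Suc n"
    using n(1) ends by (cases "Suc n = L") (simp_all add: nat_add_distrib)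
  then show ?thesis using arc by (simp add: cyclic_nth_def n_def)
qed

text \<open>
  All the walks \<open>p s\<close> have the same length: spurs are supplied beforehand by padding, so that the
  contraction only ever moves single vertices.
\<close>

proposition cyclic_contraction:
  assumes "pair_graph H" "closed_vwalk H \<gamma>" "odd (vwalk_length \<gamma>)"
    and "(vwalk_join \<gamma> \<gamma>, [hd \<gamma>]) \<in> walk_homotopic H"
  obtains m T :: nat and p :: "nat \<Rightarrow> int \<Rightarrow> 'v" and u v
  where "odd m" "\<And>s i. p s (i + 2 * int m) = p s i" "\<And>i. p 0 (i + int m) = p 0 i"
    "\<And>s i. (p s i, p s (i + 1)) \<in> parcs H"
    "\<And>s i. (p s i, p (Suc s) (i + 1)) \<in> parcs H" "\<And>s i. (p (Suc s) i, p s (i + 1)) \<in> parcs H"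
    "\<And>s i. s \<ge> T \<Longrightarrow> p s i = (if even i then u else v)"
proof -
  define b where "b = hd \<gamma>"
  define e where "e = \<gamma> ! 1"
  have \<gamma>: "vwalk \<gamma> (with_proj H)" "last \<gamma> = b" "\<gamma> \<noteq> []" and odd: "odd (length \<gamma> - 1)"
    using assms(2,3) by (auto simp: closed_vwalk_def b_def vwalk_def)
  have len: "length \<gamma> \<ge> 2" using odd by (cases \<gamma>; cases "tl \<gamma>") auto
  have be: "(b, e) \<in> parcs H"
    using vwalk_nth_Suc[OF \<gamma>(1), of 0] len \<gamma>(3) by (simp add: b_def e_def hd_conv_nth)
  define S where "S = spurs b e"
  have join: "vwalk_join \<gamma> \<gamma> = \<gamma> @ tl \<gamma>" by (simp add: vwalk_join_def)
  have ww: "vwalk (\<gamma> @ tl \<gamma>) (with_proj H)" "last (\<gamma> @ tl \<gamma>) = b"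
    using loops_at_join[of \<gamma> H b \<gamma>] \<gamma> join by (auto simp: loops_at_iff b_def)
  obtain k l where kl: "((\<gamma> @ tl \<gamma>) @ S k, [b] @ S l) \<in> (vertex_swap H)\<^sup>*"
    using walk_homotopic_vertex_swaps[OF assms(1) assms(4)[unfolded join] ww be]
    by (auto simp: S_def b_def)
  \<comment> \<open>The padding is split evenly: both copies of \<open>\<gamma>\<close> carry
    \<open>k\<close> detours, so that the first stage runs twice through \<open>\<delta>\<close> and
    has the length of \<open>\<delta>\<close> as a period.\<close>
  define \<delta> where "\<delta> = \<gamma> @ S k"
  have tl\<delta>: "tl \<delta> = tl \<gamma> @ S k" using \<gamma>(3) by (simp add: \<delta>_def)
  have \<delta>: "vwalk \<delta> (with_proj H)" "last \<delta> = b" "hd \<delta> = b" "\<delta> \<noteq> []"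
    using vwalk_append_spurs[OF assms(1) \<gamma>(1,2) be] \<gamma> by (auto simp: \<delta>_def S_def b_def)
  \<comment> \<open>The detours after the first copy slide to the end; there \<open>kl\<close>
    applies, with \<open>k\<close> further detours left over.\<close>
  have "(\<gamma> @ S k @ tl \<gamma>, \<gamma> @ tl \<gamma> @ S k) \<in> (vertex_swap H)\<^sup>*"
    unfolding S_def by (rule spurs_slide[OF assms(1) ww(1) \<gamma>(3,2) ww(2) be])
  moreover have w0: "vwalk (\<delta> @ tl \<delta>) (with_proj H)"
    using loops_at_join[of \<delta> H b \<delta>] \<delta> by (auto simp: loops_at_iff vwalk_join_def)
  moreover have "vwalk (\<gamma> @ S k @ tl \<gamma>) (with_proj H)"
    using w0 vwalkI_append_l[of "\<delta> @ tl \<gamma>" "S k"] \<gamma>(3) by (simp add: tl\<delta>) (simp add: \<delta>_def)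
  ultimately have "(\<delta> @ tl \<delta>, (\<gamma> @ tl \<gamma> @ S k) @ S k) \<in> (vertex_swap H)\<^sup>*"
    using vertex_swaps_context[of "\<gamma> @ S k @ tl \<gamma>" "\<gamma> @ tl \<gamma> @ S k" H "[]" "S k"]
    by (simp add: tl\<delta>) (simp add: \<delta>_def)
  moreover have "(((\<gamma> @ tl \<gamma>) @ S k) @ S k, ([b] @ S l) @ S k) \<in> (vertex_swap H)\<^sup>*"
    using vertex_swaps_context[OF kl, of "[]" "S k"]
      vwalk_append_spurs[OF assms(1) ww be, of "k + k"] by (simp add: S_def spurs_add)
  ultimately have "(\<delta> @ tl \<delta>, b # S (l + k)) \<in> (vertex_swap H)\<^sup>*"
    by (simp add: S_def spurs_add)
  then obtain T where "(\<delta> @ tl \<delta>, b # S (l + k)) \<in> vertex_swap H ^^ T"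
    using rtrancl_imp_relpow by blast
  then obtain f where f: "f 0 = \<delta> @ tl \<delta>" "f T = b # S (l + k)"
    and fs: "\<And>s. s < T \<Longrightarrow> (f s, f (Suc s)) \<in> vertex_swap H"
    unfolding relpow_fun_conv by blast
  \<comment> \<open>Every detour adds two arcs, so \<open>m\<close> inherits its parity from
    \<open>\<gamma>\<close>.\<close>
  define m where "m = length \<delta> - 1"
  have lenk: "length \<delta> = length \<gamma> + 2 * k" by (simp add: \<delta>_def S_def)
  have m: "odd m" "m > 0" "length \<delta> = Suc m"
    using odd len lenk by (auto simp: m_def)
  have inv: "vwalk (f s) (with_proj H) \<and> length (f s) = Suc (2 * m) \<and> hd (f s) = b \<and> last (f s) = b"
    if "s \<le> T" for s
    using that
  proof (induction s)
    case 0
    then show ?case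
      using f(1) w0 \<delta> m by (auto simp: last_append last_tl)
  next
    case (Suc s)
    then show ?case using vertex_swapD[OF fs[of s]] by auto
  qed
  \<comment> \<open>From stage \<open>T\<close> on the walk stays at the oscillation between
    \<open>b\<close> and \<open>e\<close>.\<close>
  define p where "p = (\<lambda>s. cyclic_nth (2 * m) (f (min s T)))"
  have step: "(p s i, cyclic_nth (2 * m) w (i + 1)) \<in> parcs H" if "(f (min s T), w) \<in> (vertex_swap H)\<^sup>=" for s i w
    using cyclic_nth_step[OF that, of "2 * m" i] inv[of "min s T"] m by (simp add: p_def)
  have next_rel: "(f (min s T), f (min (Suc s) T)) \<in> (vertex_swap H)\<^sup>=" for s
    using fs[of s] by (cases "s < T") (auto simp: min_def)
  show thesis
  proof (rule that[of m p T b e])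
    show "odd m" by (rule m)
    show "p s (i + 2 * int m) = p s i" for s i
      by (simp add: p_def cyclic_nth_def)
    show "p 0 (i + int m) = p 0 i" for i
    proof -
      have nth: "(\<delta> @ tl \<delta>) ! n = \<delta> ! (n mod m)" if "n < 2 * m" for n
      proof (cases "n < m")
        case False
        define r where "r = n - m"
        have r: "n = m + r" "r < m" using that False by (auto simp: r_def)
        then show ?thesis
          using \<delta> m last_conv_nth[OF \<delta>(4)] hd_conv_nth[OF \<delta>(4)]
          by (cases r) (auto simp: nth_append nth_tl simp flip: add_Suc_right)
      qed (use m in \<open>simp add: nth_append\<close>)
      have "p 0 j = \<delta> ! nat (j mod int m)" for j
      proof -
        have "nat (j mod int (2 * m)) mod m = nat ((j mod int (2 * m)) mod int m)"
          using m by (simp add: nat_mod_distrib)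
        also have "(j mod int (2 * m)) mod int m = j mod int m" by (simp add: mod_mod_cancel)
        finally show ?thesis
          using nth[of "nat (j mod int (2 * m))"] m f(1)
          by (simp add: p_def cyclic_nth_def nat_less_iff)
      qed
      then show ?thesis by simp
    qed
    show "(p s i, p s (i + 1)) \<in> parcs H" for s i
      using step[of s "f (min s T)" i] by (simp add: p_def)
    show "(p s i, p (Suc s) (i + 1)) \<in> parcs H" for s i
      using step[OF next_rel, of s i] by (simp add: p_def)
    show "(p (Suc s) i, p s (i + 1)) \<in> parcs H" for s i
    proof -
      have "(f (min (Suc s) T), f (min s T)) \<in> (vertex_swap H)\<^sup>="
        using next_rel[of s] sym_vertex_swap[of H] by (auto dest: symD)
      from step[OF this, of i] show ?thesis by (simp add: p_def)
    qed
    show "p s i = (if even i then b else e)" if "s \<ge> T" for s i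
    proof -
      have "f T = b # S (l + k)" "l + k = m" using f(2) inv[of T] by (auto simp: S_def)
      moreover have "nat (i mod (2 * int m)) \<le> 2 * m"
        using m by (simp add: nat_le_iff order_less_imp_le)
      moreover have "even (nat (i mod (2 * int m))) \<longleftrightarrow> even i"
        using m by (simp add: even_nat_iff dvd_mod_iff)
      ultimately show ?thesis
        using that nth_Cons_spurs[of "nat (i mod (2 * int m))" m b e]
        by (simp add: p_def cyclic_nth_def min_def S_def)
    qed
  qed
qed

section \<open>From the sphere to the graph\<close>

lemma periodic_int:
  fixes f :: "int \<Rightarrow> 'b"
  assumes "\<And>i. f (i + q) = f i"
  shows "f (i + n * q) = f i"
proof (induction n rule: int_induct[where k = 0])
  case (step1 n)
  then show ?case using assms[of "i + n * q"] by (simp add: algebra_simps)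
next
  case (step2 n)
  then show ?case using assms[of "i + (n - 1) * q"] by (simp add: algebra_simps)
qed simp

text \<open>Since \<open>u\<close> stays away from 0, the quotient \<open>- u' / u\<close> is close
  to 1, where \<open>Arg\<close> is continuous with value 0. The factor \<open>m / pi\<close>
  measures angles so that a full turn is \<open>2 * m\<close> and the antipode is the half turn
  \<open>m\<close>.\<close>

lemma Arg_near_opposite:
  fixes c :: real and m :: nat
  assumes "c > 0" "m > 0"
  shows "\<exists>\<epsilon>>0. \<forall>u u'. norm u \<ge> c \<longrightarrow> norm (u + u') \<le> \<epsilon> \<longrightarrow>
    (\<exists>n::int. \<bar>m / pi * Arg u' - m / pi * Arg u - real m - 2 * real m * real_of_int n\<bar> < 1)"
proof -
  have "isCont Arg 1" by (rule continuous_at_Arg) auto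
  moreover have "0 < pi / m" using assms by simp
  ultimately obtain \<delta> where \<delta>: "\<delta> > 0" "\<And>q. dist q 1 < \<delta> \<Longrightarrow> \<bar>Arg q\<bar> < pi / m"
    unfolding continuous_at_eps_delta by (metis Arg_1 diff_zero dist_real_def)
  \<comment> \<open>The bound \<open>c / 2\<close> excludes \<open>u' = 0\<close>.\<close>
  define \<epsilon> where "\<epsilon> = min (c * \<delta> / 2) (c / 2)"
  have "\<epsilon> > 0" using assms \<delta> by (simp add: \<epsilon>_def)
  moreover have "\<exists>n::int. \<bar>m / pi * Arg u' - m / pi * Arg u - real m - 2 * real m * real_of_int n\<bar> < 1"
    if u: "norm u \<ge> c" and uu: "norm (u + u') \<le> \<epsilon>" for u u'
  proof -
    define q where "q = - u' / u"
    have u0: "u \<noteq> 0" "norm u > 0" using u assms(1) by auto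
    have "norm (q - 1) = norm (u + u') / norm u"
    proof -
      have "q - 1 = - (u + u') / u" using u0 by (simp add: q_def field_simps)
      then show ?thesis by (simp only: norm_divide norm_minus_cancel)
    qed
    also have "\<dots> \<le> \<epsilon> / c" using u uu assms(1) \<open>\<epsilon> > 0\<close> by (intro frac_le) auto
    also have "\<dots> < \<delta>"
    proof -
      have "\<epsilon> \<le> c * \<delta> / 2" by (simp add: \<epsilon>_def)
      also have "\<dots> < \<delta> * c" using assms(1) \<delta>(1) by simp
      finally show ?thesis using assms(1) by (simp add: field_simps)
    qed
    finally have q: "\<bar>Arg q\<bar> < pi / m" using \<delta>(2) by (simp add: dist_norm)
    have u'0: "u' \<noteq> 0"
    proof
      assume "u' = 0"
      then have "c \<le> c / 2" using u uu by (simp add: \<epsilon>_def)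
      then show False using assms(1) by simp
    qed
    then have q0: "q \<noteq> 0" using u0 by (simp add: q_def)
    have "u' = - 1 * u * q" using u0 by (simp add: q_def)
    then have "sgn u' = - 1 * sgn u * sgn q" by (metis sgn_minus sgn_mult sgn_one)
    then have "cis (Arg u') = cis pi * cis (Arg u) * cis (Arg q)"
      using u0 u'0 q0 by (simp add: cis_Arg)
    then have "cis (Arg u') = cis (pi + Arg u + Arg q)"
      by (simp only: cis_mult)
    then have "sin (Arg u') = sin (pi + Arg u + Arg q) \<and> cos (Arg u') = cos (pi + Arg u + Arg q)"
      by (simp only: cis.code complex.inject)
    then obtain n :: int where n: "Arg u' = pi + Arg u + Arg q + 2 * pi * n"
      unfolding sin_cos_eq_iff by blast
    have "m / pi * Arg u' - m / pi * Arg u - real m - 2 * real m * real_of_int n = m / pi * Arg q"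
      unfolding n by (simp add: field_simps)
    moreover have "\<bar>m / pi * Arg q\<bar> < 1"
      using q assms(2) by (simp add: abs_mult field_simps)
    ultimately show ?thesis by metis
  qed
  ultimately show ?thesis by blast
qed

text \<open>Even values fix the parity of index differences: an odd difference of absolute value
  below 3 can only be 1 or -1.\<close>

definition even_round :: "real \<Rightarrow> int" where
  "even_round x = 2 * round (x / 2)"

lemma even_round_near: "\<bar>of_int (even_round x) - x\<bar> \<le> 1"
  using of_int_round_abs_le[of "x / 2"] unfolding even_round_def of_int_mult of_int_numeral by linarith

lemma even_even_round [simp]: "even (even_round x)"
  by (simp add: even_round_def)

lemma nat_floor_diff_le_1:
  assumes "\<bar>x - y\<bar> \<le> (1::real)"
  shows "nat \<lfloor>x\<rfloor> = nat \<lfloor>y\<rfloor> \<or> nat \<lfloor>y\<rfloor> = Suc (nat \<lfloor>x\<rfloor>) \<or> nat \<lfloor>x\<rfloor> = Suc (nat \<lfloor>y\<rfloor>)"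
  using assms by linarith

text \<open>
  The sphere, seen in \<open>complex \<times> real\<close>, is cut along the equator. The contraction \<open>p\<close> fills the
  northern hemisphere and colours it by its vertices with even index; the southern hemisphere carries the
  antipodal picture with the odd indices. On the equator the two agree because \<open>p 0\<close> has the odd
  period \<open>m\<close>.
\<close>

proposition antipodal_map_exists:
  fixes p :: "nat \<Rightarrow> int \<Rightarrow> 'v" and E :: "'v rel" and m T :: nat and c :: real
  assumes "sym E" "odd m"
    and per: "\<And>s i. p s (i + 2 * int m) = p s i" and per0: "\<And>i. p 0 (i + int m) = p 0 i"
    and adj: "\<And>s i. (p s i, p s (i + 1)) \<in> E"
      "\<And>s i. (p s i, p (Suc s) (i + 1)) \<in> E" "\<And>s i. (p (Suc s) i, p s (i + 1)) \<in> E"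
    and const: "\<And>s i. s \<ge> T \<Longrightarrow> p s i = (if even i then u0 else v0)"
    and "c > 0"
  shows "\<exists>\<epsilon>>0. \<exists>\<Psi> :: complex \<times> real \<Rightarrow> 'v.
    \<forall>k k'. norm k \<ge> c \<longrightarrow> norm k' \<ge> c \<longrightarrow> norm (k + k') \<le> \<epsilon> \<longrightarrow> (\<Psi> k, \<Psi> k') \<in> E"
proof -
  have sym: "(y, x) \<in> E" if "(x, y) \<in> E" for x y using assms(1) that by (rule symD)
  have m: "m > 0" using assms(2) by (auto intro: Nat.gr0I)
  have near: "(p s i, p s' j) \<in> E"
    if "s = s' \<or> s' = Suc s \<or> s = Suc s'" "j = i + d + n * (2 * int m)" "d = 1 \<or> d = -1" for s s' i j d n
  proof -
    have "p s' j = p s' (i + d)" using periodic_int[of "p s'" "2 * int m" "i + d" n] per that(2) by simp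
    moreover have "(p s i, p s' (i + d)) \<in> E"
      using that(1,3) adj[of s i] adj[of s' i] adj[of s "i - 1"] adj[of s' "i - 1"] by (auto intro: sym)
    ultimately show ?thesis by simp
  qed
  have uv: "(u0, v0) \<in> E" "(v0, u0) \<in> E"
    using adj(1)[of T 0] const[of T 0] const[of T 1] sym by auto
  obtain \<epsilon>1 where \<epsilon>1: "\<epsilon>1 > 0"
    "\<And>u u'. norm u \<ge> c / 4 \<Longrightarrow> norm (u + u') \<le> \<epsilon>1 \<Longrightarrow>
      \<exists>n::int. \<bar>m / pi * Arg u' - m / pi * Arg u - real m - 2 * real m * real_of_int n\<bar> < 1"
    using Arg_near_opposite[of "c / 4" m] \<open>c > 0\<close> m by auto
  \<comment> \<open>Layers of thickness \<open>\<eta>\<close> complete the contraction below height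
    \<open>c / 2\<close>. Around the poles, where \<open>Arg\<close> is not under control, the
    colour then depends on the parity of the index only.\<close>
  define \<eta> where "\<eta> = c / (2 * (real T + 1))"
  have \<eta>: "\<eta> > 0" using \<open>c > 0\<close> by (simp add: \<eta>_def)
  define lev where "lev r = nat \<lfloor>r / \<eta>\<rfloor>" for r
  define ix where "ix u = even_round (m / pi * Arg u)" for u
  define \<Psi> where "\<Psi> = (\<lambda>(u, r). if r \<ge> 0 then p (lev r) (ix u) else p (lev (- r)) (ix u + int m))"
  \<comment> \<open>The bound \<open>\<eta> / 2\<close> lets nearby heights differ by at most one
    layer and puts heights up to \<open>\<epsilon>\<close> into layer 0.\<close>
  define \<epsilon> where "\<epsilon> = min \<epsilon>1 (min (\<eta> / 2) (c / 4))"
  have \<epsilon>: "\<epsilon> > 0" "\<epsilon> \<le> \<epsilon>1" "\<epsilon> \<le> \<eta> / 2" "\<epsilon> \<le> c / 4"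
    using \<epsilon>1(1) \<eta> \<open>c > 0\<close> by (auto simp: \<epsilon>_def)
  have lev_T: "lev r \<ge> T" if "r \<ge> c / 2" for r
  proof -
    have "real T * \<eta> \<le> (real T + 1) * \<eta>" using \<eta> by simp
    also have "\<dots> = c / 2"
    proof -
      have "real T + 1 \<noteq> 0" by linarith
      then show ?thesis by (simp add: \<eta>_def divide_simps)
    qed
    finally have "real T * \<eta> \<le> r" using that by simp
    then have "of_int (int T) \<le> r / \<eta>" using \<eta> by (simp add: field_simps)
    then have "int T \<le> \<lfloor>r / \<eta>\<rfloor>" by (simp only: le_floor_iff)
    then show ?thesis unfolding lev_def by linarith
  qed
  have lev_near: "lev r = lev r' \<or> lev r' = Suc (lev r) \<or> lev r = Suc (lev r')" if "\<bar>r - r'\<bar> \<le> \<epsilon>" for r r'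
    unfolding lev_def
  proof (rule nat_floor_diff_le_1)
    have "\<bar>r / \<eta> - r' / \<eta>\<bar> = \<bar>r - r'\<bar> / \<eta>" using \<eta> by (simp add: field_simps flip: diff_divide_distrib)
    also have "\<dots> \<le> 1" using that \<epsilon>(3) \<eta> by simp
    finally show "\<bar>r / \<eta> - r' / \<eta>\<bar> \<le> 1" .
  qed
  have lev_0: "lev r = 0" if "r \<le> \<epsilon>" for r
  proof -
    have "r / \<eta> < 1" using that \<epsilon>(3) \<eta> by (simp add: field_simps)
    then show ?thesis unfolding lev_def by linarith
  qed
  have phase: "\<exists>d n. ix u' = ix u + int m + d + n * (2 * int m) \<and> (d = 1 \<or> d = -1)"
    if "norm u \<ge> c / 4" "norm (u + u') \<le> \<epsilon>" for u u'
  proof -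
    have "norm (u + u') \<le> \<epsilon>1" using that(2) \<epsilon>(2) by linarith
    with \<epsilon>1(2)[OF that(1)] obtain n :: int
      where n: "\<bar>m / pi * Arg u' - m / pi * Arg u - real m - 2 * real m * real_of_int n\<bar> < 1" by blast
    \<comment> \<open>The two roundings contribute at most 1 each and the angle less than 1;
      \<open>d\<close> is odd because \<open>m\<close> is.\<close>
    define d where "d = ix u' - ix u - int m - n * (2 * int m)"
    have "real_of_int d = real_of_int (ix u') - real_of_int (ix u) - real m - 2 * real m * real_of_int n"
      by (simp add: d_def mult.commute)
    then have "\<bar>real_of_int d\<bar> < 3"
      using n even_round_near[of "m / pi * Arg u'"] even_round_near[of "m / pi * Arg u"]
      unfolding ix_def by linarith
    moreover have "odd d" unfolding d_def ix_def using assms(2) by simp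
    moreover from calculation(1) have "-3 < d" "d < 3" by linarith+
    ultimately have "d = 1 \<or> d = -1" by presburger
    then show ?thesis unfolding d_def by (intro exI[of _ d] exI[of _ n]) (auto simp: d_def)
  qed
  have opp: "(\<Psi> (u, r), \<Psi> (u', r')) \<in> E"
    if k: "norm (u, r) \<ge> c" "norm (u', r') \<ge> c" "norm (u + u') \<le> \<epsilon>" "\<bar>r + r'\<bar> \<le> \<epsilon>" and r: "r \<ge> 0" "r' < 0"
    for u r u' r'
  proof (cases "norm u \<ge> c / 4")
    case True
    obtain d n where "ix u' = ix u + int m + d + n * (2 * int m)" "d = 1 \<or> d = -1"
      using phase[OF True k(3)] by blast
    \<comment> \<open>The antipode and the southern shift contribute \<open>m\<close> each, together
      a full period, and leave the difference \<open>d\<close>.\<close>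
    then have "(p (lev r) (ix u), p (lev (- r')) (ix u' + int m)) \<in> E"
      using k(4) r lev_near[of r "- r'"]
      by (intro near[where d = d and n = "n + 1"]) (auto simp: algebra_simps)
    then show ?thesis using r by (simp add: \<Psi>_def)
  next
    case False
    \<comment> \<open>Near the axis both points are at least \<open>c / 2\<close> from the
      equatorial plane; their colours are \<open>u0\<close> in the north and \<open>v0\<close> in
      the south.\<close>
    have "norm u' \<le> norm (u + u') + norm u" using norm_triangle_ineq4[of "u + u'" u] by simp
    then have "norm u' \<le> c / 2" using False k(3) \<epsilon>(4) by linarith
    moreover have "norm (u, r) \<le> norm u + \<bar>r\<bar>" "norm (u', r') \<le> norm u' + \<bar>r'\<bar>"
      using norm_Pair_le[of u r] norm_Pair_le[of u' r'] by simp_all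
    ultimately have "lev r \<ge> T" "lev (- r') \<ge> T" using False k(1,2) r by (auto intro!: lev_T)
    then show ?thesis using r const uv assms(2) by (simp add: \<Psi>_def ix_def)
  qed
  have "(\<Psi> k, \<Psi> k') \<in> E" if k: "norm k \<ge> c" "norm k' \<ge> c" "norm (k + k') \<le> \<epsilon>" for k k'
  proof -
    obtain u r u' r' where kk: "k = (u, r)" "k' = (u', r')" by (cases k; cases k')
    have n: "norm (u + u') \<le> \<epsilon>" "\<bar>r + r'\<bar> \<le> \<epsilon>"
      using k(3) norm_fst_le[of "u + u'" "r + r'"] norm_snd_le[of "r + r'" "u + u'"] by (auto simp: kk)
    have eq: "norm (u' + u) \<le> \<epsilon>" "\<bar>r' + r\<bar> \<le> \<epsilon>" using n by (simp_all add: add.commute)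
    consider "r \<ge> 0" "r' < 0" | "r < 0" "r' \<ge> 0" | "r \<ge> 0" "r' \<ge> 0" | "r < 0" "r' < 0" by linarith
    then show ?thesis
    proof cases
      case 1
      then show ?thesis using opp k n by (simp add: kk)
    next
      case 2
      then show ?thesis using opp[of u' r' u r] k eq sym by (simp add: kk)
    next
      case 3
      \<comment> \<open>Nearly antipodal points on one side of the equator lie in layer 0, where the
        period \<open>m\<close> absorbs the half turn.\<close>
      then have r: "lev r = 0" "lev r' = 0" "\<bar>r\<bar> \<le> \<epsilon>" using n by (auto intro: lev_0)
      have "norm u \<ge> c / 4" using k(1) norm_Pair_le[of u r] r(3) \<epsilon>(4) \<open>c > 0\<close> by (simp add: kk)
      from phase[OF this n(1)] obtain d l where d: "ix u' = ix u + int m + d + l * (2 * int m)" "d = 1 \<or> d = -1"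
        by blast
      have "p 0 (ix u') = p 0 (ix u' - int m)" using per0[of "ix u' - int m"] by simp
      moreover have "(p 0 (ix u), p 0 (ix u' - int m)) \<in> E"
        using d by (intro near[where d = d and n = l]) auto
      ultimately show ?thesis using r(1,2) 3 by (simp add: \<Psi>_def kk)
    next
      case 4
      then have r: "lev (- r) = 0" "lev (- r') = 0" "\<bar>r\<bar> \<le> \<epsilon>" using n by (auto intro: lev_0)
      have "norm u \<ge> c / 4" using k(1) norm_Pair_le[of u r] r(3) \<epsilon>(4) \<open>c > 0\<close> by (simp add: kk)
      from phase[OF this n(1)] obtain d l where d: "ix u' = ix u + int m + d + l * (2 * int m)" "d = 1 \<or> d = -1"
        by blast
      have "(p 0 (ix u + int m), p 0 (ix u')) \<in> E"
        using d by (intro near[where d = d and n = l]) auto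
      then show ?thesis using r(1,2) 4 by (simp add: \<Psi>_def kk per0)
    qed
  qed
  then show ?thesis using \<epsilon>(1) by blast
qed

section \<open>An antipodal map on joins of cyclic groups\<close>

text \<open>
  Polar representation of the join of \<open>k\<close> copies of \<open>\<int>/M\<close>: the entry \<open>w j = t * \<mu> ^ z\<close> is the
  point \<open>z\<close> of the \<open>j\<close>-th copy, taken with weight \<open>t\<close>.
\<close>

definition join_cone :: "nat \<Rightarrow> nat \<Rightarrow> (nat \<Rightarrow> complex) set" where
  "join_cone M k = {w. \<forall>j<k. \<exists>t\<ge>0. \<exists>z::nat. w j = of_real t * cis (2 * pi / M) ^ z}"

lemma root_of_unity_eq_power:
  assumes "z ^ N = 1" "N > 0" "N dvd M" "M > 0"
  shows "\<exists>p>0. z = cis (2 * pi / M) ^ p"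
proof -
  obtain q where q: "M = N * q" using assms(3) by blast
  have "z ^ M = 1" unfolding q power_mult assms(1) by simp
  then have "z \<in> (\<lambda>j. cis (2 * pi * real j / real M)) ` {..<M}"
    using Complex.bij_betw_roots_unity[OF assms(4)] by (auto simp: bij_betw_def)
  then obtain j where j: "z = cis (2 * pi * real j / real M)" by blast
  have "cis (2 * pi / M) ^ (j + M) = z * cis (2 * pi / M) ^ M"
    unfolding power_add Complex.DeMoivre j by (simp add: mult.commute)
  also have "cis (2 * pi / M) ^ M = 1"
    unfolding Complex.DeMoivre using assms(4) by simp
  finally show ?thesis using assms(4) by (intro exI[of _ "j + M"]) simp
qed

text \<open>
  The zero set of \<open>z ^ N - w ^ N\<close> on the three-sphere is a link of \<open>N\<close> circles, and
  on it the \<open>N\<close>-th power of \<open>w * cnj z\<close> is positive. So \<open>(z ^ N - w ^ N, w * cnj z)\<close> omits the ray through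
  \<open>(0, -\<kappa>)\<close> with \<open>\<kappa> ^ N = -1\<close>: as a map between spheres it is null-homotopic, although it is
  equivariant, and hence extends to a further join with \<open>\<int>/M\<close>.
\<close>

lemma omitted_ray:
  fixes z w \<kappa> \<omega> :: complex
  assumes "z ^ N = w ^ N" "w * cnj z + \<kappa> * \<omega> = 0" "\<kappa> ^ N = -1" "even N" "N > 0"
    "\<omega> ^ N = of_real t" "t \<ge> 0"
  shows "z = 0 \<and> w = 0 \<and> \<omega> = 0"
proof -
  have "complex_of_real ((norm z)\<^sup>2 ^ N) = (z * cnj z) ^ N"
    by (simp only: of_real_power[of "(norm z)\<^sup>2" N] complex_norm_square)
  also have "\<dots> = (w * cnj z) ^ N" using assms(1) by (simp add: power_mult_distrib)
  also have "w * cnj z = - (\<kappa> * \<omega>)" using assms(2) by (simp add: add_eq_0_iff)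
  also have "(- (\<kappa> * \<omega>)) ^ N = of_real (- t)"
    using assms(3,4,6) by (simp add: power_mult_distrib)
  finally have "(norm z)\<^sup>2 ^ N = - t" by (simp only: of_real_eq_iff)
  moreover have "(norm z)\<^sup>2 ^ N \<ge> 0" by simp
  ultimately have "(norm z)\<^sup>2 ^ N = 0" "t = 0" using assms(7) by linarith+
  then have "z = 0" "\<omega> = 0" using assms(5,6) by auto
  moreover from this have "w = 0" using assms(1,5) by (metis power_eq_0_iff zero_power)
  ultimately show ?thesis by simp
qed

text \<open>Induction on the number of copies. A map for the rotations \<open>A'\<close> and
  \<open>B'\<close>, where \<open>A' ^ N = A\<close> and \<open>B' = A' * B\<close>, has order
  dividing \<open>N * N\<close>; following it by
  \<open>(z, w) \<mapsto> (z ^ N - w ^ N, w * cnj z)\<close> gives the rotations \<open>A\<close>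
  and \<open>B' * cnj A' = B\<close>. The rays through \<open>(0, - \<kappa> * B ^ z)\<close> are
  omitted, so the new copy, added in the opposite directions, creates no zero.\<close>

proposition equivariant_join_map:
  fixes A B :: complex
  assumes "A ^ N = 1" "B ^ N = 1" "even N" "N > 0"
  shows "\<exists>M (F :: (nat \<Rightarrow> complex) \<Rightarrow> complex \<times> complex). M > 0 \<and> N dvd M \<and> continuous_on UNIV F \<and>
    (\<forall>w. F (\<lambda>j. cis (2 * pi / M) * w j) = (A * fst (F w), B * snd (F w))) \<and>
    (\<forall>w\<in>join_cone M k. F w = 0 \<longrightarrow> (\<forall>j<k. w j = 0))"
  using assms
proof (induction k arbitrary: A B N)
  case 0
  then show ?case by (intro exI[of _ N] exI[of _ "\<lambda>_. 0"]) (auto simp: zero_prod_def)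
next
  case (Suc k)
  define A' where "A' = cis (Arg A / N)"
  define B' where "B' = A' * B"
  have "norm A ^ N = 1" using Suc.prems(1) by (metis norm_one norm_power)
  then have "norm A = 1" using Suc.prems(4) power_eq_imp_eq_base[of "norm A" N 1] by simp
  then have "A \<noteq> 0" "sgn A = A" by (auto simp: sgn_eq)
  then have A': "A' ^ N = A"
    unfolding A'_def Complex.DeMoivre using Suc.prems(4) by (simp add: cis_Arg)
  have A'1: "A' ^ (N * N) = 1" using A' Suc.prems(1) by (simp add: power_mult)
  have B'N: "B' ^ N = A" using A' Suc.prems(2) by (simp add: B'_def power_mult_distrib)
  then have B'1: "B' ^ (N * N) = 1" using Suc.prems(1) by (simp add: power_mult)
  obtain M F where M: "M > 0" "N * N dvd M" and F: "continuous_on UNIV F"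
    and eq: "\<And>w. F (\<lambda>j. cis (2 * pi / M) * w j) = (A' * fst (F w), B' * snd (F w))"
    and nz: "\<And>w. w \<in> join_cone M k \<Longrightarrow> F w = 0 \<Longrightarrow> \<forall>j<k. w j = 0"
    using Suc.IH[OF A'1 B'1] Suc.prems(3,4) by auto
  have NM: "N dvd M" using M(2) by (rule dvd_mult_left)
  define \<mu> where "\<mu> = cis (2 * pi / M)"
  \<comment> \<open>The new coordinate enters by its \<open>p\<close>-th power, which is multiplied
    by \<open>B\<close> when the coordinate is multiplied by \<open>\<mu>\<close>.\<close>
  obtain p where p: "p > 0" "B = \<mu> ^ p"
    using root_of_unity_eq_power[OF Suc.prems(2,4) NM M(1)] unfolding \<mu>_def by blast
  define \<kappa> where "\<kappa> = cis (pi / N)"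
  have \<kappa>: "\<kappa> ^ N = -1" unfolding \<kappa>_def Complex.DeMoivre using Suc.prems(4) by simp
  define G where "G w = (fst (F w) ^ N - snd (F w) ^ N, snd (F w) * cnj (fst (F w)) + \<kappa> * w k ^ p)" for w
  have "continuous_on UNIV G"
    unfolding G_def using F by (intro continuous_intros) auto
  moreover have "G (\<lambda>j. \<mu> * w j) = (A * fst (G w), B * snd (G w))" for w
  proof -
    have "B' * x * cnj (A' * y) = B * (x * cnj y)" for x y
    proof -
      have "A' * cnj A' = 1" by (simp add: A'_def cis_cnj cis_mult)
      moreover have "B' * x * cnj (A' * y) = (A' * cnj A') * (B * (x * cnj y))"
        by (simp add: B'_def)
      ultimately show ?thesis by simp
    qed
    then show ?thesis
      unfolding G_def \<mu>_def eq
      by (simp add: power_mult_distrib A' B'N p(2)[unfolded \<mu>_def] algebra_simps)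
  qed
  moreover have "\<forall>j<Suc k. w j = 0" if w: "w \<in> join_cone M (Suc k)" and G0: "G w = 0" for w
  proof -
    obtain t z where tz: "t \<ge> 0" "w k = of_real t * \<mu> ^ z"
      using w lessI[of k] unfolding join_cone_def \<mu>_def by blast
    have "(w k ^ p) ^ N = of_real ((t ^ p) ^ N) * ((\<mu> ^ p) ^ N) ^ z"
      unfolding tz(2) power_mult_distrib of_real_power power_mult[symmetric] by (simp add: mult.commute mult.left_commute)
    then have *: "(w k ^ p) ^ N = of_real ((t ^ p) ^ N)" using p(2) Suc.prems(2) by simp
    have "fst (F w) = 0 \<and> snd (F w) = 0 \<and> w k ^ p = 0"
      by (rule omitted_ray[OF _ _ \<kappa> Suc.prems(3,4) *])
        (use G0 tz(1) in \<open>simp_all add: G_def zero_prod_def\<close>)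
    moreover have "w \<in> join_cone M k" using w by (auto simp: join_cone_def)
    ultimately show ?thesis using nz[of w] by (auto simp: less_Suc_eq prod_eq_iff)
  qed
  ultimately show ?case using M(1) NM unfolding \<mu>_def by (intro exI[of _ M] exI[of _ G]) blast
qed

text \<open>Under the rotations by \<open>\<i>\<close> and \<open>- \<i>\<close> both
  \<open>z ^ 2 - w ^ 2\<close> and \<open>w * cnj z\<close> change sign. The real part of the latter
  is enough to exclude zeros: where \<open>z = w\<close> or \<open>z = - w\<close> it is the squared
  norm up to sign.\<close>

lemma antipodal_join_map:
  "\<exists>M (f :: (nat \<Rightarrow> complex) \<Rightarrow> complex \<times> real). M > 0 \<and> continuous_on UNIV f \<and>
    (\<forall>w. f (\<lambda>j. cis (2 * pi / M) * w j) = - f w) \<and>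
    (\<forall>w\<in>join_cone M k. f w = 0 \<longrightarrow> (\<forall>j<k. w j = 0))"
proof -
  have "\<i> ^ 4 = 1" "(- \<i>) ^ 4 = 1" by (simp_all add: eval_nat_numeral)
  from equivariant_join_map[OF this, of k] obtain M F where M: "M > 0" and F: "continuous_on UNIV F"
    and eq: "\<And>w. F (\<lambda>j. cis (2 * pi / M) * w j) = (\<i> * fst (F w), - \<i> * snd (F w))"
    and nz: "\<And>w. w \<in> join_cone M k \<Longrightarrow> F w = 0 \<Longrightarrow> \<forall>j<k. w j = 0"
    by auto
  define f where "f w = (fst (F w) ^ 2 - snd (F w) ^ 2, Re (snd (F w) * cnj (fst (F w))))" for w
  have "continuous_on UNIV f"
    unfolding f_def using F by (intro continuous_intros) auto
  moreover have "f (\<lambda>j. cis (2 * pi / M) * w j) = - f w" for w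
    unfolding f_def eq by (simp add: power_mult_distrib)
  moreover have "\<forall>j<k. w j = 0" if w: "w \<in> join_cone M k" and f0: "f w = 0" for w
  proof (rule nz[OF w])
    have pm: "fst (F w) = snd (F w) \<or> fst (F w) = - snd (F w)"
      and re: "Re (snd (F w) * cnj (fst (F w))) = 0"
      using f0 by (simp_all add: f_def zero_prod_def power2_eq_iff)
    have sq: "Re (x * cnj x) = (norm x)\<^sup>2" for x
      by (simp only: complex_norm_square[symmetric] Re_complex_of_real)
    from pm have "(norm (snd (F w)))\<^sup>2 = 0"
    proof
      assume eq: "fst (F w) = snd (F w)"
      show ?thesis using re unfolding eq sq .
    next
      assume eq: "fst (F w) = - snd (F w)"
      show ?thesis
        using re unfolding eq complex_cnj_minus mult_minus_right uminus_complex.simps sq by simp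
    qed
    then show "F w = 0" using pm by (auto simp: prod_eq_iff)
  qed
  ultimately show ?thesis using M by (intro exI[of _ M] exI[of _ f]) blast
qed

section \<open>Compactness and uniform estimates\<close>

lemma compact_PiE_UNIV:
  fixes S :: "nat \<Rightarrow> complex set"
  assumes "\<And>j. compact (S j)"
  shows "compact {w. \<forall>j. w j \<in> S j}"
proof -
  have "compactin (product_topology (\<lambda>_. euclidean) UNIV) (PiE UNIV S)"
    using assms by (simp add: compactin_PiE)
  moreover have "PiE UNIV S = {w. \<forall>j. w j \<in> S j}" by auto
  ultimately show ?thesis by (simp add: euclidean_product_topology)
qed

text \<open>The coordinates built from markers will lie here. The weights are not normalised; having
  them at most 2, and one at least 1, makes the set compact and keeps it away from the apex of the
  cone. Entries from \<open>k\<close> on are 0 to have compactness in the full function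
  space.\<close>

definition join_base :: "nat \<Rightarrow> nat \<Rightarrow> (nat \<Rightarrow> complex) set" where
  "join_base M k = {w. (\<forall>j<k. \<exists>t\<in>{0..2}. \<exists>z<M. w j = of_real t * cis (2 * pi / M) ^ z) \<and>
     (\<forall>j\<ge>k. w j = 0) \<and> (\<exists>j<k. norm (w j) \<ge> 1)}"

text \<open>Sorting by a coordinate of norm at least 1 gives finitely many products of compact
  sets.\<close>

lemma compact_join_base: "compact (join_base M k)"
proof -
  define S where "S = (\<Union>z<M. (\<lambda>t. of_real t * cis (2 * pi / M) ^ z) ` {0..2::real})"
  have "compact S"
    unfolding S_def by (intro compact_UN compact_continuous_image continuous_intros) auto
  define S1 where "S1 = S \<inter> {x. norm x \<ge> 1}"
  have "closed {x::complex. norm x \<ge> 1}" by (intro closed_Collect_le continuous_intros)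
  with \<open>compact S\<close> have "compact S1" unfolding S1_def by (rule compact_Int_closed)
  have "join_base M k = (\<Union>i<k. {w. \<forall>j. w j \<in> (if j = i then S1 else if j < k then S else {0})})"
    (is "_ = ?R")
  proof
    show "join_base M k \<subseteq> ?R"
    proof
      fix w assume w: "w \<in> join_base M k"
      then obtain i where "i < k" "norm (w i) \<ge> 1" by (auto simp: join_base_def)
      moreover have "w j \<in> S" if "j < k" for j
        using w that unfolding join_base_def S_def by force
      moreover have "w j = 0" if "\<not> j < k" for j
        using w that by (auto simp: join_base_def)
      ultimately show "w \<in> ?R" by (auto simp: S1_def intro!: bexI[of _ i])
    qed
    show "?R \<subseteq> join_base M k"
    proof
      fix w assume "w \<in> ?R"
      then obtain i where i: "i < k" "\<And>j. w j \<in> (if j = i then S1 else if j < k then S else {0})"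
        by blast
      have "w j \<in> S" if "j < k" for j using i(2)[of j] that by (auto simp: S1_def split: if_splits)
      moreover have "norm (w i) \<ge> 1" using i(2)[of i] by (simp add: S1_def)
      moreover have "w j = 0" if "j \<ge> k" for j using i(2)[of j] i(1) that by auto
      ultimately show "w \<in> join_base M k" using i(1) by (fastforce simp: join_base_def S_def)
    qed
  qed
  then show ?thesis
  proof (simp only:, intro compact_UN finite_lessThan)
    fix i
    show "compact {w. \<forall>j. w j \<in> (if j = i then S1 else if j < k then S else {0})}"
      using \<open>compact S\<close> \<open>compact S1\<close> by (intro compact_PiE_UNIV) simp
  qed
qed

lemma dist_fun_le:
  fixes v w :: "nat \<Rightarrow> complex"
  assumes "\<And>j. dist (v j) (w j) \<le> \<delta>"
  shows "dist v w \<le> 2 * \<delta>"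
proof (rule field_le_epsilon)
  fix e :: real assume "e > 0"
  then obtain N where N: "(1/2)^N < e" using real_arch_pow_inv[of e "1/2"] by auto
  have "finite {dist (v (from_nat n)) (w (from_nat n))|n. n \<le> N}" by simp
  then have "Max {dist (v (from_nat n)) (w (from_nat n))|n. n \<le> N} \<le> \<delta>"
    using assms by (subst Max_le_iff) auto
  then show "dist v w \<le> 2 * \<delta> + e"
    using dist_fun_le_dist_first_terms[of v w N] N by linarith
qed

text \<open>Compactness yields the lower bound \<open>c\<close>, fixed before
  \<open>\<epsilon>\<close>, and uniform continuity: if \<open>w'\<close> is near the rotated
  \<open>w\<close>, then \<open>f w'\<close> is near the value of \<open>f\<close> there, which is
  \<open>- f w\<close>.\<close>

proposition uniform_antipodal_join_map:
  "\<exists>M (f :: (nat \<Rightarrow> complex) \<Rightarrow> complex \<times> real) c. M > 0 \<and> c > 0 \<and>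
    (\<forall>w\<in>join_base M k. norm (f w) \<ge> c) \<and>
    (\<forall>\<epsilon>>0. \<exists>\<delta>>0. \<forall>w\<in>join_base M k. \<forall>w'\<in>join_base M k.
       (\<forall>j<k. norm (w' j - cis (2 * pi / M) * w j) \<le> \<delta>) \<longrightarrow> norm (f w + f w') \<le> \<epsilon>)"
proof -
  obtain M and f :: "(nat \<Rightarrow> complex) \<Rightarrow> complex \<times> real" where M: "M > 0" and f: "continuous_on UNIV f"
    and eq: "\<And>w. f (\<lambda>j. cis (2 * pi / M) * w j) = - f w"
    and nz: "\<And>w. w \<in> join_cone M k \<Longrightarrow> f w = 0 \<Longrightarrow> \<forall>j<k. w j = 0"
    using antipodal_join_map[of k] by blast
  define \<mu> where "\<mu> = cis (2 * pi / M)"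
  have \<mu>M: "\<mu> ^ M = 1" unfolding \<mu>_def Complex.DeMoivre using M by simp
  have fK: "continuous_on (join_base M k) f" using f continuous_on_subset by blast
  have "\<exists>c>0. \<forall>w\<in>join_base M k. norm (f w) \<ge> c"
  proof (cases "join_base M k = {}")
    case False
    have "continuous_on (join_base M k) (\<lambda>w. norm (f w))" by (intro continuous_intros fK)
    from continuous_attains_inf[OF compact_join_base False this]
    obtain v where v: "v \<in> join_base M k" "\<forall>w\<in>join_base M k. norm (f v) \<le> norm (f w)" by blast
    have "v \<in> join_cone M k" "\<exists>j<k. v j \<noteq> 0"
      using v(1) by (fastforce simp: join_base_def join_cone_def)+
    then have "norm (f v) > 0" using nz[of v] by auto
    then show ?thesis using v(2) by blast
  qed (auto intro: exI[of _ 1])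
  then obtain c where c: "c > 0" "\<forall>w\<in>join_base M k. norm (f w) \<ge> c" by blast
  have "\<exists>\<delta>>0. \<forall>w\<in>join_base M k. \<forall>w'\<in>join_base M k.
       (\<forall>j<k. norm (w' j - \<mu> * w j) \<le> \<delta>) \<longrightarrow> norm (f w + f w') \<le> \<epsilon>" if "\<epsilon> > 0" for \<epsilon>
  proof -
    have "uniformly_continuous_on (join_base M k) f"
      by (rule compact_uniformly_continuous[OF fK compact_join_base])
    then obtain d where d: "d > 0"
      "\<And>v w. v \<in> join_base M k \<Longrightarrow> w \<in> join_base M k \<Longrightarrow> dist w v < d \<Longrightarrow> dist (f w) (f v) < \<epsilon>"
      using \<open>\<epsilon> > 0\<close> unfolding uniformly_continuous_on_def by metis
    have "norm (f w + f w') \<le> \<epsilon>" if w: "w \<in> join_base M k" "w' \<in> join_base M k"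
      and close: "\<And>j. j < k \<Longrightarrow> norm (w' j - \<mu> * w j) \<le> d / 4" for w w'
    proof -
      let ?v = "\<lambda>j. \<mu> * w j"
      have "\<exists>t\<in>{0..2}. \<exists>z<M. ?v j = of_real t * \<mu> ^ z" if "j < k" for j
      proof -
        obtain t z where tz: "t \<in> {0..2}" "w j = of_real t * \<mu> ^ z"
          using w(1) \<open>j < k\<close> unfolding join_base_def \<mu>_def by blast
        have "\<mu> ^ (Suc z) = (\<mu> ^ M) ^ (Suc z div M) * \<mu> ^ (Suc z mod M)"
          by (metis power_add power_mult mult_div_mod_eq)
        then have "?v j = of_real t * \<mu> ^ (Suc z mod M)" using tz(2) \<mu>M by simp
        then show ?thesis using tz(1) M by (intro bexI[of _ t] exI[of _ "Suc z mod M"]) auto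
      qed
      moreover have "norm (?v j) = norm (w j)" for j by (simp add: \<mu>_def norm_mult)
      ultimately have v: "?v \<in> join_base M k" using w(1) by (auto simp: join_base_def \<mu>_def)
      \<comment> \<open>The distance in the function space is at most twice the coordinatewise
        bound, hence at most \<open>d / 2 < d\<close>.\<close>
      have "dist (w' j) (?v j) \<le> d / 4" for j
        using close[of j] w v d(1) by (cases "j < k") (auto simp: join_base_def dist_norm)
      then have "dist w' ?v \<le> 2 * (d / 4)" by (rule dist_fun_le)
      then have "dist (f w') (f ?v) < \<epsilon>" using d v w by simp
      then show ?thesis using eq[of w] by (simp add: \<mu>_def dist_norm add.commute)
    qed
    then show ?thesis using d(1) by (intro exI[of _ "d / 4"]) auto
  qed
  then show ?thesis using M c unfolding \<mu>_def by blast
qed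

section \<open>Clopen markers\<close>

lemma metrizable_separable_imp_second_countable:
  assumes "metrizable_space X" "separable_space X"
  shows "second_countable X"
proof -
  obtain S d where "Metric_space S d" and X: "X = Metric_space.mtopology S d"
    using assms(1) by (auto simp: metrizable_space_def)
  interpret Metric_space S d by fact
  obtain C where C: "countable C" "C \<subseteq> S" "mtopology closure_of C = S"
    using assms(2) by (auto simp: separable_space_def X)
  define \<B> where "\<B> = (\<lambda>(c, n). mball c (1 / real (Suc n))) ` (C \<times> (UNIV :: nat set))"
  have "countable \<B>" unfolding \<B>_def using C(1) by (intro countable_image countable_SIGMA) auto
  moreover have "openin X V" if "V \<in> \<B>" for V using that by (auto simp: \<B>_def X)
  moreover have "\<exists>V\<in>\<B>. x \<in> V \<and> V \<subseteq> U" if U: "openin X U" "x \<in> U" for U x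
  proof -
    obtain r where r: "r > 0" "mball x r \<subseteq> U"
      using U unfolding X openin_mtopology by blast
    have xS: "x \<in> S" using U openin_subset[of X U] by (auto simp: X)
    obtain n where n: "1 / real (Suc n) < r / 2"
      using r(1) reals_Archimedean[of "r / 2"] by (auto simp: inverse_eq_divide)
    have "x \<in> mtopology closure_of C" using C(3) xS by simp
    moreover have "openin mtopology (mball x (1 / real (Suc n)))" by simp
    moreover have "x \<in> mball x (1 / real (Suc n))" using xS by simp
    ultimately obtain c where c: "c \<in> C" "c \<in> mball x (1 / real (Suc n))"
      unfolding in_closure_of by blast
    have "x \<in> mball c (1 / real (Suc n))" using c(2) by (simp add: commute)
    moreover have "mball c (1 / real (Suc n)) \<subseteq> mball x r"
    proof
      fix y assume y: "y \<in> mball c (1 / real (Suc n))"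
      then have "d x y \<le> d x c + d c y" using c(2) by (auto intro: triangle)
      also have "\<dots> < r" using y c(2) n by simp
      finally show "y \<in> mball x r" using y xS by simp
    qed
    ultimately show ?thesis using c(1) r(2) unfolding \<B>_def by blast
  qed
  ultimately show ?thesis unfolding second_countable_def by blast
qed

section \<open>Clopen sets and maximal discrete sets\<close>

definition clopenin :: "'a topology \<Rightarrow> 'a set \<Rightarrow> bool" where
  "clopenin X U \<longleftrightarrow> openin X U \<and> closedin X U"

lemma clopenin_subset: "clopenin X U \<Longrightarrow> U \<subseteq> topspace X"
  by (simp add: clopenin_def openin_subset)

lemma clopenin_topspace [simp]: "clopenin X (topspace X)"
  and clopenin_empty [simp]: "clopenin X {}"
  by (simp_all add: clopenin_def)

lemma clopenin_Int: "clopenin X U \<Longrightarrow> clopenin X V \<Longrightarrow> clopenin X (U \<inter> V)"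
  and clopenin_Un: "clopenin X U \<Longrightarrow> clopenin X V \<Longrightarrow> clopenin X (U \<union> V)"
  and clopenin_Diff: "clopenin X U \<Longrightarrow> clopenin X V \<Longrightarrow> clopenin X (U - V)"
  by (auto simp: clopenin_def openin_diff closedin_diff)

lemma clopenin_UN: "finite I \<Longrightarrow> (\<And>i. i \<in> I \<Longrightarrow> clopenin X (U i)) \<Longrightarrow> clopenin X (\<Union>i\<in>I. U i)"
  by (induction I rule: finite_induct) (auto intro: clopenin_Un)

lemma continuous_action_imp_continuous_map:
  assumes "continuous_action X act"
  shows "continuous_map X X (act g)"
proof -
  have "continuous_map X (prod_topology (discrete_topology UNIV) X) (\<lambda>x. (g, x))"
    by (intro continuous_map_pairedI) (auto simp: continuous_map_const)
  then show ?thesis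
    using assms continuous_map_compose[of X _ "\<lambda>x. (g, x)" X "\<lambda>(g, x). act g x"]
    unfolding continuous_action_def by (auto simp: comp_def)
qed

lemma clopenin_preimage:
  assumes "continuous_action X act" "clopenin X U"
  shows "clopenin X {x \<in> topspace X. act g x \<in> U}"
  using assms continuous_action_imp_continuous_map[OF assms(1), of g]
  by (auto simp: clopenin_def openin_continuous_map_preimage closedin_continuous_map_preimage)

lemma act_topspace:
  assumes "continuous_action X act" "x \<in> topspace X"
  shows "act g x \<in> topspace X"
  using continuous_action_imp_continuous_map[OF assms(1), of g] assms(2)
  by (auto simp: continuous_map_def)

text \<open>Freeness separates \<open>x\<close> from its finitely many translates by
  \<open>S\<close>; disjoint neighbourhoods, pulled back and intersected, contain a clopen
  one.\<close>

lemma displaced_neighbourhood: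
  assumes X: "Hausdorff_space X" "zero_dimensional X"
    and act: "continuous_action X act" "free_action X act"
    and S: "finite S" "0 \<notin> S" and x: "x \<in> topspace X"
  obtains U where "clopenin X U" "x \<in> U" "\<And>y s. y \<in> U \<Longrightarrow> s \<in> S \<Longrightarrow> act s y \<notin> U"
proof -
  have "\<exists>V. openin X V \<and> x \<in> V \<and> (\<forall>y\<in>V. act s y \<notin> V)" if "s \<in> S" for s
  proof -
    have "x \<noteq> act s x" using act(2) x S(2) that unfolding free_action_def by metis
    then obtain A B where AB: "openin X A" "openin X B" "x \<in> A" "act s x \<in> B" "disjnt A B"
      using X(1) x act_topspace[OF act(1) x] unfolding Hausdorff_space_def by meson
    have "openin X {y \<in> topspace X. act s y \<in> B}"
      using openin_continuous_map_preimage[OF continuous_action_imp_continuous_map[OF act(1)] AB(2)] .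
    then have "openin X (A \<inter> {y \<in> topspace X. act s y \<in> B})" using AB(1) by blast
    then show ?thesis using AB x by (intro exI[of _ "A \<inter> {y \<in> topspace X. act s y \<in> B}"]) (auto simp: disjnt_def)
  qed
  then obtain V where V: "\<And>s. s \<in> S \<Longrightarrow> openin X (V s) \<and> x \<in> V s \<and> (\<forall>y\<in>V s. act s y \<notin> V s)" by metis
  have "openin X (topspace X \<inter> (\<Inter>s\<in>S. V s))"
    using V S(1) by (cases "S = {}") (auto intro!: openin_Int openin_INT)
  moreover have "x \<in> topspace X \<inter> (\<Inter>s\<in>S. V s)" using V x by auto
  ultimately obtain U where U: "clopenin X U" "x \<in> U" "U \<subseteq> topspace X \<inter> (\<Inter>s\<in>S. V s)"
    using X(2) unfolding zero_dimensional_def clopenin_def by meson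
  show thesis
  proof
    show "act s y \<notin> U" if "y \<in> U" "s \<in> S" for y s
      using V[OF that(2)] U(3) that by blast
  qed (use U in auto)
qed

text \<open>A greedy choice along a countable cover by clopen sets \<open>U n\<close> without
  \<open>S\<close>-related points: stage \<open>n\<close> adds at once all points of
  \<open>Y \<inter> U n\<close> that are not related to a point chosen before.\<close>

lemma clopen_maximal_discrete_set:
  fixes act :: "'g :: group_add \<Rightarrow> 'a \<Rightarrow> 'a"
  assumes X: "Hausdorff_space X" "zero_dimensional X" "Lindelof_space X"
    and act: "continuous_action X act" "free_action X act"
    and S: "finite S" "0 \<notin> S" "\<And>s. s \<in> S \<Longrightarrow> - s \<in> S" and Y: "clopenin X Y"
  shows "\<exists>M. clopenin X M \<and> M \<subseteq> Y \<and> (\<forall>x\<in>M. \<forall>s\<in>S. act s x \<notin> M) \<and>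
    (\<forall>x\<in>Y. x \<in> M \<or> (\<exists>s\<in>S. act s x \<in> M))"
proof (cases "topspace X = {}")
  case True
  then show ?thesis using clopenin_subset[OF Y] by (intro exI[of _ "{}"]) auto
next
  case False
  let ?good = "\<lambda>U. clopenin X U \<and> (\<forall>y\<in>U. \<forall>s\<in>S. act s y \<notin> U)"
  have "\<exists>\<V>. countable \<V> \<and> \<V> \<subseteq> {U. ?good U} \<and> \<Union>\<V> = topspace X"
  proof (rule Lindelof_spaceD[OF X(3)])
    show "\<Union>{U. ?good U} = topspace X"
    proof
      show "topspace X \<subseteq> \<Union>{U. ?good U}"
      proof
        fix x assume "x \<in> topspace X"
        then obtain U where "clopenin X U" "x \<in> U" "\<And>y s. y \<in> U \<Longrightarrow> s \<in> S \<Longrightarrow> act s y \<notin> U"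
          by (rule displaced_neighbourhood[OF X(1,2) act S(1,2)]) blast
        then show "x \<in> \<Union>{U. ?good U}" by blast
      qed
    qed (auto dest: clopenin_subset)
  qed (auto simp: clopenin_def)
  then obtain \<V> where \<V>: "countable \<V>" "\<V> \<subseteq> {U. ?good U}" "\<Union>\<V> = topspace X"
    by (elim exE conjE)
  have ne: "\<V> \<noteq> {}" using \<V>(3) False by (metis Union_empty)
  define U where "U = from_nat_into \<V>"
  have rangeU: "range U = \<V>" unfolding U_def using ne \<V>(1) by (rule range_from_nat_into)
  have U: "clopenin X (U n)" "\<And>y s. y \<in> U n \<Longrightarrow> s \<in> S \<Longrightarrow> act s y \<notin> U n" for n
    using \<V>(2) rangeU by auto
  have cover: "\<exists>n. x \<in> U n" if "x \<in> topspace X" for x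
    using that \<V>(3) rangeU by blast
  have inv: "act (- s) (act s x) = x" if "x \<in> topspace X" for s x
    using act(1) that unfolding continuous_action_def by (metis left_minus)
  define A where "A = rec_nat {} (\<lambda>n A. A \<union> {x \<in> Y \<inter> U n. \<forall>s\<in>S. act s x \<notin> A})"
  have A_simps: "A 0 = {}" "\<And>n. A (Suc n) = A n \<union> {x \<in> Y \<inter> U n. \<forall>s\<in>S. act s x \<notin> A n}"
    by (simp_all add: A_def)
  have A_cl: "clopenin X (A n)" for n
  proof (induction n)
    case (Suc n)
    have "clopenin X (\<Union>s\<in>S. {x \<in> topspace X. act s x \<in> A n})"
      by (intro clopenin_UN S(1) clopenin_preimage[OF act(1) Suc])
    then have "clopenin X (A n \<union> (Y \<inter> U n - (\<Union>s\<in>S. {x \<in> topspace X. act s x \<in> A n})))"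
      by (intro clopenin_Un clopenin_Diff clopenin_Int Suc Y U)
    moreover have "A (Suc n) = A n \<union> (Y \<inter> U n - (\<Union>s\<in>S. {x \<in> topspace X. act s x \<in> A n}))"
      using clopenin_subset[OF Y] by (auto simp: A_simps)
    ultimately show ?case by simp
  qed (simp add: A_simps)
  have A_mono: "A m \<subseteq> A n" if "m \<le> n" for m n
    using lift_Suc_mono_le[of A, OF _ that] by (auto simp: A_simps)
  have A_Y: "A n \<subseteq> Y" for n by (induction n) (auto simp: A_simps)
  have A_disc: "act s x \<notin> A n" if "x \<in> A n" "s \<in> S" for x s n
    using that
  proof (induction n)
    case (Suc n)
    have "x \<in> topspace X" using Suc.prems(1) A_Y clopenin_subset[OF Y] by blast
    \<comment> \<open>If only \<open>act s x\<close> is new, then \<open>- s\<close> leads back to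
      the old point \<open>x\<close>, which would have blocked it; this is where \<open>S\<close>
      must be symmetric.\<close>
    then show ?case
      using Suc S(3)[of s] U(2)[of x n s] inv[of x s] by (fastforce simp: A_simps)
  qed (simp add: A_simps)
  define M where "M = (\<Union>n. A n)"
  have M_disc: "act s x \<notin> M" if x: "x \<in> M" and s: "s \<in> S" for x s
  proof
    assume "act s x \<in> M"
    then obtain m n where "act s x \<in> A m" "x \<in> A n" using x unfolding M_def by blast
    then have "act s x \<in> A (max m n)" "x \<in> A (max m n)"
      using A_mono[of m "max m n"] A_mono[of n "max m n"] by auto
    then show False using A_disc s by blast
  qed
  \<comment> \<open>Points of \<open>U n\<close> are decided by the clopen set \<open>A n\<close>
    alone, so the complement of \<open>M\<close> is open as well.\<close>
  have M_iff: "x \<in> M \<longleftrightarrow> (\<forall>s\<in>S. act s x \<notin> A n)" if "x \<in> Y \<inter> U n" for x n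
  proof
    assume "\<forall>s\<in>S. act s x \<notin> A n"
    then have "x \<in> A (Suc n)" using that by (simp add: A_simps)
    then show "x \<in> M" by (auto simp: M_def)
  qed (use M_disc in \<open>auto simp: M_def\<close>)
  have "openin X M" unfolding M_def using A_cl by (auto simp: clopenin_def)
  moreover have "closedin X M"
  proof -
    have "topspace X - M = (topspace X - Y) \<union> (\<Union>n. (Y \<inter> U n) \<inter> (\<Union>s\<in>S. {x \<in> topspace X. act s x \<in> A n}))"
      (is "_ = ?R")
    proof (intro equalityI subsetI)
      fix x assume x: "x \<in> topspace X - M"
      then obtain n where "x \<in> U n" using cover by blast
      then show "x \<in> ?R" using x M_iff[of x n] by auto
    next
      fix x assume "x \<in> ?R"
      then consider "x \<in> topspace X - Y" | n s where "x \<in> Y \<inter> U n" "s \<in> S" "x \<in> topspace X" "act s x \<in> A n"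
        by blast
      then show "x \<in> topspace X - M"
      proof cases
        case 1
        then show ?thesis using A_Y by (auto simp: M_def)
      next
        case (2 n s)
        then show ?thesis using M_iff[OF 2(1)] by blast
      qed
    qed
    moreover have "clopenin X ((Y \<inter> U n) \<inter> (\<Union>s\<in>S. {x \<in> topspace X. act s x \<in> A n}))" for n
      by (intro clopenin_Int Y U clopenin_UN S(1) clopenin_preimage[OF act(1) A_cl])
    then have "openin X (\<Union>n. (Y \<inter> U n) \<inter> (\<Union>s\<in>S. {x \<in> topspace X. act s x \<in> A n}))"
      by (auto simp: clopenin_def)
    moreover have "openin X (topspace X - Y)"
      using clopenin_Diff[OF clopenin_topspace Y] by (simp add: clopenin_def)
    ultimately have "openin X (topspace X - M)" by (simp add: openin_Un)
    moreover have "M \<subseteq> topspace X" using A_Y clopenin_subset[OF Y] by (auto simp: M_def)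
    ultimately show ?thesis by (simp add: closedin_def)
  qed
  ultimately have "clopenin X M" by (simp add: clopenin_def)
  moreover have "x \<in> M \<or> (\<exists>s\<in>S. act s x \<in> M)" if x: "x \<in> Y" for x
  proof -
    obtain n where "x \<in> U n" using cover x clopenin_subset[OF Y] by blast
    then show ?thesis using M_iff[of x n] x by (auto simp: M_def)
  qed
  moreover have "M \<subseteq> Y" unfolding M_def using A_Y by (rule UN_least)
  ultimately show ?thesis using M_disc by (intro exI[of _ M]) blast
qed

section \<open>The sup norm, pigeonholes and marker sets\<close>

definition vnorm :: "int ^ 'd \<Rightarrow> int" where
  "vnorm g = Max (range (\<lambda>i. \<bar>g $ i\<bar>))"

lemma vnorm_le_iff: "vnorm g \<le> r \<longleftrightarrow> (\<forall>i. \<bar>g $ i\<bar> \<le> r)"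
  unfolding vnorm_def by (subst Max_le_iff) auto

lemma abs_component_le_vnorm: "\<bar>g $ i\<bar> \<le> vnorm g"
  using vnorm_le_iff[of g "vnorm g"] by simp

lemma vnorm_nonneg: "0 \<le> vnorm g"
  using abs_component_le_vnorm[of g undefined] by linarith

lemma vnorm_zero [simp]: "vnorm 0 = 0"
  by (intro antisym vnorm_nonneg) (simp add: vnorm_le_iff)

lemma vnorm_add: "vnorm (g + h) \<le> vnorm g + vnorm h"
  unfolding vnorm_le_iff
proof
  fix i
  show "\<bar>(g + h) $ i\<bar> \<le> vnorm g + vnorm h"
    using abs_component_le_vnorm[of g i] abs_component_le_vnorm[of h i] by simp
qed

lemma vnorm_minus [simp]: "vnorm (- g) = vnorm g"
  by (simp add: vnorm_def)

lemma vnorm_diff: "vnorm (g - h) \<le> vnorm g + vnorm h"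
  using vnorm_add[of g "- h"] by simp

lemma vnorm_axis: "vnorm (axis i 1) \<le> 1"
  by (simp add: vnorm_le_iff axis_def)

lemma finite_vnorm_ball: "finite {g :: int ^ 'd. vnorm g \<le> r}"
proof -
  have "{g :: int ^ 'd. vnorm g \<le> r} \<subseteq> vec_lambda ` (PiE UNIV (\<lambda>_. {-r..r}))"
  proof
    fix g :: "int ^ 'd" assume g: "g \<in> {g. vnorm g \<le> r}"
    have "g $ i \<in> {-r..r}" for i
    proof -
      have "\<bar>g $ i\<bar> \<le> r" using g by (simp add: vnorm_le_iff)
      then show ?thesis by auto
    qed
    then show "g \<in> vec_lambda ` (PiE UNIV (\<lambda>_. {-r..r}))"
      by (intro image_eqI[of _ _ "vec_nth g"]) auto
  qed
  then show ?thesis by (rule finite_subset) (intro finite_imageI finite_PiE; simp)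
qed

text \<open>Division by \<open>R\<close> sorts vectors of norm at most \<open>5 * R\<close> into
  cells with quotients from -5 to 5 in each coordinate. One vector more than there are cells forces
  two into a common cell.\<close>

definition marker_count :: "'d::finite itself \<Rightarrow> nat" where
  "marker_count _ = 11 ^ CARD('d) + 1"

lemma vnorm_pigeonhole:
  fixes g :: "nat \<Rightarrow> int ^ 'd"
  assumes "R > 0" "\<And>j. j < marker_count TYPE('d) \<Longrightarrow> vnorm (g j) \<le> 5 * R"
  obtains i j where "i < j" "j < marker_count TYPE('d)" "vnorm (g i - g j) \<le> R"
proof -
  let ?n = "marker_count TYPE('d)"
  define cell where "cell j = (\<lambda>i. (g j $ i) div R)" for j
  let ?P = "PiE (UNIV :: 'd set) (\<lambda>_. {-5..5::int})"
  have "cell ` {..<?n} \<subseteq> ?P"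
  proof (intro image_subsetI PiE_I)
    fix j i assume "j \<in> {..<?n}"
    then have "\<bar>g j $ i\<bar> \<le> 5 * R" using assms(2) by (simp add: vnorm_le_iff)
    then have *: "(-5) * R \<le> g j $ i" "g j $ i \<le> 5 * R" by linarith+
    have "((-5) * R) div R \<le> g j $ i div R" "g j $ i div R \<le> (5 * R) div R"
      by (rule zdiv_mono1[OF *(1) assms(1)], rule zdiv_mono1[OF *(2) assms(1)])
    then show "cell j i \<in> {-5..5}" using assms(1) nonzero_mult_div_cancel_right[of R "-5"] by (simp add: cell_def)
  qed simp
  moreover have "finite ?P" "card ?P = 11 ^ CARD('d)"
    by (auto intro!: finite_PiE simp: card_PiE)
  ultimately have "card (cell ` {..<?n}) \<le> 11 ^ CARD('d)" by (metis card_mono)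
  then have "\<not> inj_on cell {..<?n}" by (auto dest: card_image simp: marker_count_def)
  then obtain i j where ij: "i < ?n" "j < ?n" "i \<noteq> j" "cell i = cell j" by (auto simp: inj_on_def)
  have close: "vnorm (g i - g j) \<le> R" if "cell i = cell j" for i j
    unfolding vnorm_le_iff
  proof
    fix l
    have "R * (g i $ l div R) = R * (g j $ l div R)" using fun_cong[OF that, of l] by (simp add: cell_def)
    moreover have "g i $ l = R * (g i $ l div R) + g i $ l mod R"
      "g j $ l = R * (g j $ l div R) + g j $ l mod R" by simp_all
    moreover have "0 \<le> g i $ l mod R" "g i $ l mod R < R" "0 \<le> g j $ l mod R" "g j $ l mod R < R"
      using assms(1) by simp_all
    ultimately show "\<bar>(g i - g j) $ l\<bar> \<le> R" unfolding vector_minus_component by linarith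
  qed
  show thesis
  proof (cases "i < j")
    case True
    then show ?thesis using that ij close by blast
  next
    case False
    then have "j < i" "cell j = cell i" using ij by simp_all
    then show ?thesis using that[of j i] ij close by blast
  qed
qed

text \<open>The number of marker sets is bounded independently of \<open>R\<close>.\<close>

proposition clopen_markers:
  fixes X :: "'a topology" and act :: "int ^ 'd \<Rightarrow> 'a \<Rightarrow> 'a"
  assumes X: "Hausdorff_space X" "zero_dimensional X" "Lindelof_space X"
    and act: "continuous_action X act" "free_action X act" and R: "R > 0"
  shows "\<exists>M :: nat \<Rightarrow> 'a set. (\<forall>j. clopenin X (M j)) \<and>
    (\<forall>j. \<forall>x\<in>M j. \<forall>g. act g x \<in> M j \<longrightarrow> vnorm g \<le> 5 * R \<longrightarrow> g = 0) \<and>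
    (\<forall>x\<in>topspace X. \<exists>j<marker_count TYPE('d). \<exists>g. vnorm g \<le> R \<and> act g x \<in> M j)"
proof -
  define S where "S = {g :: int ^ 'd. vnorm g \<le> 5 * R} - {0}"
  have S: "finite S" "0 \<notin> S" "\<And>s. s \<in> S \<Longrightarrow> - s \<in> S"
    using finite_vnorm_ball[of "5 * R"] by (auto simp: S_def)
  have "\<forall>Y. \<exists>M. clopenin X Y \<longrightarrow> clopenin X M \<and> M \<subseteq> Y \<and> (\<forall>x\<in>M. \<forall>s\<in>S. act s x \<notin> M) \<and>
      (\<forall>x\<in>Y. x \<in> M \<or> (\<exists>s\<in>S. act s x \<in> M))"
    using clopen_maximal_discrete_set[OF X act S] by blast
  then obtain mk where mk: "\<And>Y. clopenin X Y \<Longrightarrow> clopenin X (mk Y) \<and> mk Y \<subseteq> Y \<and>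
      (\<forall>x\<in>mk Y. \<forall>s\<in>S. act s x \<notin> mk Y) \<and> (\<forall>x\<in>Y. x \<in> mk Y \<or> (\<exists>s\<in>S. act s x \<in> mk Y))"
    by metis
  \<comment> \<open>\<open>Y n\<close> holds the points not within \<open>R\<close> of the first
    \<open>n\<close> marker sets; the next set is maximal discrete in it.\<close>
  define Y where "Y = rec_nat (topspace X)
    (\<lambda>_ Y. Y - (\<Union>g\<in>{g. vnorm g \<le> R}. {x \<in> topspace X. act g x \<in> mk Y}))"
  have Y_simps: "Y 0 = topspace X"
    "\<And>n. Y (Suc n) = Y n - (\<Union>g\<in>{g. vnorm g \<le> R}. {x \<in> topspace X. act g x \<in> mk (Y n)})"
    by (simp_all add: Y_def)
  have Y_cl: "clopenin X (Y n)" for n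
  proof (induction n)
    case (Suc n)
    then show ?case
      unfolding Y_simps
      by (intro clopenin_Diff clopenin_UN finite_vnorm_ball clopenin_preimage act) (use mk in auto)
  qed (simp add: Y_simps)
  have Y_anti: "Y n \<subseteq> Y m" if "m \<le> n" for m n
    using lift_Suc_antimono_le[of Y, OF _ that] by (auto simp: Y_simps)
  define M where "M n = mk (Y n)" for n
  have M: "clopenin X (M n)" "M n \<subseteq> Y n" "\<And>x s. x \<in> M n \<Longrightarrow> s \<in> S \<Longrightarrow> act s x \<notin> M n"
    "\<And>x. x \<in> Y n \<Longrightarrow> x \<in> M n \<or> (\<exists>s\<in>S. act s x \<in> M n)" for n
    using mk[OF Y_cl[of n]] unfolding M_def by blast+
  \<comment> \<open>A point missed by all sets lies in every \<open>Y j\<close>, so by maximality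
    each set has a marker within \<open>5 * R\<close> of it. Two of these markers are within
    \<open>R\<close> of each other, but the later one was chosen outside the
    \<open>R\<close>-neighbourhood of the earlier set.\<close>
  have "\<exists>j<marker_count TYPE('d). \<exists>g. vnorm g \<le> R \<and> act g x \<in> M j" if x: "x \<in> topspace X" for x
  proof (rule ccontr)
    assume neg: "\<not> ?thesis"
    have xY: "x \<in> Y j" if "j \<le> marker_count TYPE('d)" for j
      using that
    proof (induction j)
      case (Suc j)
      then show ?case using neg unfolding Y_simps M_def by auto
    qed (simp add: Y_simps x)
    have "\<exists>g. vnorm g \<le> 5 * R \<and> act g x \<in> M j" if j: "j < marker_count TYPE('d)" for j
    proof -
      have "act 0 x = x" using act(1) x by (simp add: continuous_action_def)
      then show ?thesis
        using M(4)[OF xY[of j]] j R by (auto simp: S_def intro: exI[of _ 0])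
    qed
    then obtain g where g: "\<And>j. j < marker_count TYPE('d) \<Longrightarrow> vnorm (g j) \<le> 5 * R \<and> act (g j) x \<in> M j"
      by metis
    then obtain i j where ij: "i < j" "j < marker_count TYPE('d)" "vnorm (g i - g j) \<le> R"
      using vnorm_pigeonhole[OF R, of g] by metis
    have "act (g j) x \<in> M j" using g ij by simp
    then have y: "act (g j) x \<in> Y (Suc i)" using M(2)[of j] Y_anti[of "Suc i" j] ij(1) by auto
    have "act (g i - g j + g j) x = act (g i - g j) (act (g j) x)"
      using act(1) x unfolding continuous_action_def by blast
    then have "act (g i - g j) (act (g j) x) \<in> M i" using g[of i] ij by simp
    then show False using y ij(3) act_topspace[OF act(1) x] by (auto simp: Y_simps M_def)
  qed
  moreover have "g = 0" if "x \<in> M j" "act g x \<in> M j" "vnorm g \<le> 5 * R" for x g j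
    using M(3)[OF that(1), of g] that(2,3) by (auto simp: S_def)
  ultimately show ?thesis using M(1) by blast
qed

section \<open>Coordinates in the join\<close>

lemma power_int_root_of_unity:
  fixes \<mu> :: complex
  assumes "\<mu> ^ M = 1" "M > 0"
  shows "\<exists>z<M. \<mu> powi n = \<mu> ^ z"
proof -
  have "\<mu> \<noteq> 0" using assms by (metis power_0_left not_gr_zero zero_neq_one)
  have "\<mu> powi n = \<mu> powi (int M * (n div int M) + n mod int M)" by simp
  also have "\<dots> = (\<mu> powi int M) powi (n div int M) * \<mu> powi (n mod int M)"
    using \<open>\<mu> \<noteq> 0\<close> by (simp only: power_int_add power_int_mult simp_thms)
  also have "\<mu> powi int M = 1" using assms(1) by simp
  also have "\<mu> powi (n mod int M) = \<mu> ^ nat (n mod int M)"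
    using assms(2) by (simp add: power_int_def)
  finally have "\<mu> powi n = \<mu> ^ nat (n mod int M)" by simp
  moreover have "nat (n mod int M) < M" using assms(2) by (simp add: nat_less_iff)
  ultimately show ?thesis by blast
qed

text \<open>A marker \<open>act g x\<close> gives \<open>x\<close> the coordinate
  \<open>\<phi> g\<close>. A generator moves \<open>x\<close> but not the marker, so
  \<open>g\<close> becomes \<open>g - axis i 1\<close>: its norm changes by at most 1, and the
  height, minus the sum of its entries, grows by 1.\<close>

proposition locally_constant_join_coordinates:
  fixes X :: "'a topology" and act :: "int ^ 'd \<Rightarrow> 'a \<Rightarrow> 'a"
  assumes X: "Hausdorff_space X" "zero_dimensional X" "Lindelof_space X"
    and act: "continuous_action X act" "free_action X act" and M: "M > 0" and "\<delta> > 0"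
  shows "\<exists>w :: 'a \<Rightarrow> nat \<Rightarrow> complex.
    (\<forall>x\<in>topspace X. w x \<in> join_base M (marker_count TYPE('d))) \<and>
    (\<forall>x\<in>topspace X. \<forall>i j. norm (w (act (axis i 1) x) j - cis (2 * pi / M) * w x j) \<le> \<delta>) \<and>
    (\<forall>x\<in>topspace X. \<exists>U. openin X U \<and> x \<in> U \<and> (\<forall>y\<in>U. w y = w x))"
proof -
  define k where "k = marker_count TYPE('d)"
  define R where "R = \<lceil>1 / \<delta>\<rceil>"
  have R: "R > 0" "1 / real_of_int R \<le> \<delta>"
  proof -
    show "R > 0" using \<open>\<delta> > 0\<close> by (simp add: R_def)
    have "1 / \<delta> \<le> real_of_int R" by (simp add: R_def)
    then show "1 / real_of_int R \<le> \<delta>" using \<open>\<delta> > 0\<close> \<open>R > 0\<close> by (simp add: field_simps)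
  qed
  obtain P :: "nat \<Rightarrow> 'a set" where P: "\<And>j. clopenin X (P j)"
    and sep: "\<And>j x g. x \<in> P j \<Longrightarrow> act g x \<in> P j \<Longrightarrow> vnorm g \<le> 5 * R \<Longrightarrow> g = 0"
    and cover: "\<And>x. x \<in> topspace X \<Longrightarrow> \<exists>j<k. \<exists>g. vnorm g \<le> R \<and> act g x \<in> P j"
    using clopen_markers[OF X act R(1)] unfolding k_def by metis
  define \<mu> where "\<mu> = cis (2 * pi / M)"
  have \<mu>: "\<mu> ^ M = 1" "\<mu> \<noteq> 0" "norm \<mu> = 1" unfolding \<mu>_def Complex.DeMoivre using M by simp_all
  \<comment> \<open>The weight falls from 2 at the marker to 1 at the covering radius
    \<open>R\<close> and to 0 at \<open>2 * R\<close>: some weight is always at least 1, and none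
    jumps when a marker goes out of range. The slope is \<open>1 / R \<le> \<delta>\<close>.\<close>
  define \<tau> where "\<tau> g = real_of_int (max 0 (2 * R - vnorm g)) / R" for g :: "int ^ 'd"
  define \<phi> where "\<phi> g = of_real (\<tau> g) * \<mu> powi (- (\<Sum>l\<in>UNIV. g $ l))" for g :: "int ^ 'd"
  define B where "B = {g :: int ^ 'd. vnorm g \<le> 2 * R}"
  have "finite B" unfolding B_def by (rule finite_vnorm_ball)
  define w where "w x j = (if j < k then \<Sum>g\<in>B. if act g x \<in> P j then \<phi> g else 0 else 0)" for x j
  have act_add: "act (g + h) x = act g (act h x)" if "x \<in> topspace X" for g h x
    using act(1) that by (simp add: continuous_action_def)
  \<comment> \<open>One extra step is allowed for \<open>h\<close>; separation still applies as
    \<open>4 * R + 1 \<le> 5 * R\<close>.\<close>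
  have uniq: "g = h" if "x \<in> topspace X" "act g x \<in> P j" "act h x \<in> P j" "vnorm g \<le> 2 * R"
    "vnorm h \<le> 2 * R + 1" for g h x j
  proof -
    have "act (h - g) (act g x) = act h x" using act_add[OF that(1), of "h - g" g] by simp
    moreover have "vnorm (h - g) \<le> 5 * R" using vnorm_diff[of h g] that(4,5) R(1) by linarith
    ultimately show ?thesis using sep[of "act g x" j "h - g"] that(2,3) by simp
  qed
  \<comment> \<open>For norm \<open>2 * R + 1\<close> the vector \<open>h\<close> is outside
    \<open>B\<close> and the sum is 0, which agrees with \<open>\<phi> h = 0\<close>.\<close>
  have w_eq: "w x j = \<phi> h" if "x \<in> topspace X" "j < k" "act h x \<in> P j" "vnorm h \<le> 2 * R + 1" for x j h
  proof -
    have "w x j = (\<Sum>g\<in>B. if g = h then \<phi> h else 0)"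
      unfolding w_def using that(2) uniq[OF that(1) _ that(3) _ that(4)] that(3)
      by (auto intro!: sum.cong simp: B_def)
    also have "\<dots> = \<phi> h" using \<open>finite B\<close> by (auto simp: B_def \<phi>_def \<tau>_def)
    finally show ?thesis .
  qed
  have w_0: "w x j = 0" if "\<And>g. vnorm g \<le> 2 * R \<Longrightarrow> act g x \<notin> P j" for x j
    using that unfolding w_def B_def by (auto intro!: sum.neutral)
  have polar: "\<exists>t\<in>{0..2}. \<exists>z<M. \<phi> g = of_real t * \<mu> ^ z" for g
  proof -
    obtain z where "z < M" "\<mu> powi (- (\<Sum>l\<in>UNIV. g $ l)) = \<mu> ^ z"
      using power_int_root_of_unity[OF \<mu>(1) M] by blast
    moreover have "\<tau> g \<in> {0..2}" using R(1) vnorm_nonneg[of g] by (simp add: \<tau>_def field_simps)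
    ultimately show ?thesis unfolding \<phi>_def by auto
  qed
  have base: "w x \<in> join_base M k" if x: "x \<in> topspace X" for x
  proof -
    have "\<exists>t\<in>{0..2}. \<exists>z<M. w x j = of_real t * \<mu> ^ z" if "j < k" for j
    proof (cases "\<exists>g. vnorm g \<le> 2 * R \<and> act g x \<in> P j")
      case True
      then obtain g where "vnorm g \<le> 2 * R" "act g x \<in> P j" by blast
      then have "w x j = \<phi> g" using w_eq[OF x that] by simp
      then show ?thesis using polar by simp
    next
      case False
      then have "w x j = 0" using w_0 by blast
      then show ?thesis using M by (intro bexI[of _ 0] exI[of _ 0]) auto
    qed
    moreover have "\<exists>j<k. norm (w x j) \<ge> 1"
    proof -
      obtain j g where jg: "j < k" "vnorm g \<le> R" "act g x \<in> P j" using cover[OF x] by blast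
      then have "w x j = \<phi> g" using w_eq[OF x] R(1) by simp
      then have "norm (w x j) = \<bar>\<tau> g\<bar>" using \<mu>(3) by (simp add: \<phi>_def norm_mult norm_power_int)
      moreover have "\<tau> g \<ge> 1" using jg(2) R(1) by (simp add: \<tau>_def field_simps)
      ultimately show ?thesis using jg(1) by auto
    qed
    moreover have "w x j = 0" if "j \<ge> k" for j using that by (simp add: w_def)
    ultimately show ?thesis unfolding join_base_def \<mu>_def by blast
  qed
  have \<phi>_step: "norm (\<phi> (g - axis i 1) - \<mu> * \<phi> g) \<le> \<delta>" for g i
  proof -
    let ?e = "axis i 1 :: int ^ 'd"
    have "(\<Sum>l\<in>UNIV. ?e $ l) = 1" by (simp add: axis_def)
    then have "- (\<Sum>l\<in>UNIV. (g - ?e) $ l) = - (\<Sum>l\<in>UNIV. g $ l) + 1" by (simp add: sum_subtractf)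
    then have "\<mu> powi (- (\<Sum>l\<in>UNIV. (g - ?e) $ l)) = \<mu> powi (- (\<Sum>l\<in>UNIV. g $ l)) * \<mu>"
      using \<mu>(2) by (simp only: power_int_add_1 simp_thms)
    then have "\<phi> (g - ?e) - \<mu> * \<phi> g = of_real (\<tau> (g - ?e) - \<tau> g) * (\<mu> powi (- (\<Sum>l\<in>UNIV. g $ l)) * \<mu>)"
      unfolding \<phi>_def by (simp add: algebra_simps)
    then have "norm (\<phi> (g - ?e) - \<mu> * \<phi> g) = \<bar>\<tau> (g - ?e) - \<tau> g\<bar>"
      using \<mu>(3) by (simp only: norm_mult norm_of_real norm_power_int power_int_1_left mult_1_right)
    also have "\<dots> = \<bar>real_of_int (max 0 (2 * R - vnorm (g - ?e)) - max 0 (2 * R - vnorm g))\<bar> / R"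
      using R(1) by (simp add: \<tau>_def flip: diff_divide_distrib)
    also have "\<dots> \<le> 1 / R"
    proof (rule divide_right_mono)
      have "vnorm (g - ?e) \<le> vnorm g + 1" "vnorm g \<le> vnorm (g - ?e) + 1"
        using vnorm_diff[of g ?e] vnorm_add[of "g - ?e" ?e] vnorm_axis[of i] by simp_all
      then have "\<bar>max 0 (2 * R - vnorm (g - ?e)) - max 0 (2 * R - vnorm g)\<bar> \<le> 1" by linarith
      then show "\<bar>real_of_int (max 0 (2 * R - vnorm (g - ?e)) - max 0 (2 * R - vnorm g))\<bar> \<le> 1"
        by linarith
    qed (use R(1) in simp)
    finally show ?thesis using R(2) by linarith
  qed
  have step: "norm (w (act (axis i 1) x) j - \<mu> * w x j) \<le> \<delta>" if x: "x \<in> topspace X" for x i j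
  proof (cases "j < k")
    case True
    let ?e = "axis i 1 :: int ^ 'd" and ?y = "act (axis i 1) x"
    have y: "?y \<in> topspace X" using act_topspace[OF act(1) x] .
    have shift: "act (g - ?e) ?y = act g x" for g using act_add[OF x, of "g - ?e" ?e] by simp
    \<comment> \<open>A marker in range of one end of the edge is within \<open>2 * R + 1\<close> of
      both.\<close>
    consider g where "act g x \<in> P j" "vnorm g \<le> 2 * R + 1" "vnorm (g - ?e) \<le> 2 * R + 1"
      | "\<And>g. vnorm g \<le> 2 * R \<Longrightarrow> act g x \<notin> P j" "\<And>g. vnorm g \<le> 2 * R \<Longrightarrow> act g ?y \<notin> P j"
    proof (cases "\<exists>g. vnorm g \<le> 2 * R \<and> act g x \<in> P j")
      case True
      then obtain g where "vnorm g \<le> 2 * R" "act g x \<in> P j" by blast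
      then show thesis using that(1)[of g] vnorm_diff[of g ?e] vnorm_axis[of i] by linarith
    next
      case no: False
      show thesis
      proof (cases "\<exists>g. vnorm g \<le> 2 * R \<and> act g ?y \<in> P j")
        case True
        then obtain g where g: "vnorm g \<le> 2 * R" "act g ?y \<in> P j" by blast
        then have "act (g + ?e) x \<in> P j" using act_add[OF x] by simp
        moreover have "vnorm (g + ?e) \<le> 2 * R + 1"
          using g(1) vnorm_add[of g ?e] vnorm_axis[of i] by linarith
        ultimately show thesis using that(1)[of "g + ?e"] g(1) by simp
      next
        case False
        then show thesis using that(2) no by blast
      qed
    qed
    then show ?thesis
    proof cases
      case (1 g)
      have "w x j = \<phi> g" using w_eq[OF x True 1(1,2)] .
      moreover have "w ?y j = \<phi> (g - ?e)" using w_eq[OF y True _ 1(3)] shift 1(1) by simp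
      ultimately show ?thesis using \<phi>_step by simp
    next
      case 2
      then have "w x j = 0" "w ?y j = 0" using w_0 by blast+
      then show ?thesis using \<open>\<delta> > 0\<close> by simp
    qed
  qed (use \<open>\<delta> > 0\<close> in \<open>simp add: w_def\<close>)
  \<comment> \<open>The value \<open>w x\<close> depends on finitely many clopen conditions
    \<open>act g x \<in> P j\<close> only.\<close>
  have loc: "\<exists>U. openin X U \<and> x \<in> U \<and> (\<forall>y\<in>U. w y = w x)" if x: "x \<in> topspace X" for x
  proof -
    define V where "V j g = (let Q = {y \<in> topspace X. act g y \<in> P j} in
      if act g x \<in> P j then Q else topspace X - Q)" for j g
    have V: "openin X (V j g)" "x \<in> V j g" "\<And>y. y \<in> V j g \<Longrightarrow> act g y \<in> P j \<longleftrightarrow> act g x \<in> P j" for j g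
      using clopenin_preimage[OF act(1) P, of g j] x by (auto simp: V_def clopenin_def Let_def split: if_splits)
    define U where "U = (\<Inter>q\<in>{..<k} \<times> B. V (fst q) (snd q)) \<inter> topspace X"
    have "openin X U"
      unfolding U_def using \<open>finite B\<close> V(1) by (intro openin_INT) auto
    moreover have "x \<in> U" using x V(2) by (auto simp: U_def)
    moreover have "w y = w x" if "y \<in> U" for y
    proof
      fix j
      have "act g y \<in> P j \<longleftrightarrow> act g x \<in> P j" if "j < k" "g \<in> B" for g
        using V(3)[of y j g] \<open>y \<in> U\<close> that by (auto simp: U_def)
      then have "(\<Sum>g\<in>B. if act g y \<in> P j then \<phi> g else 0) = (\<Sum>g\<in>B. if act g x \<in> P j then \<phi> g else 0)"
        if "j < k" using that by (intro sum.cong refl) simp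
      then show "w y j = w x j" unfolding w_def by simp
    qed
    ultimately show ?thesis by (intro exI[of _ U] conjI ballI)
  qed
  show ?thesis
    unfolding k_def[symmetric] \<mu>_def[symmetric] by (intro exI[of _ w] conjI ballI allI base step loc)
qed

section \<open>Continuous homomorphisms\<close>

theorem theorem1p4:
  fixes H :: "'v pair_pre_digraph"
    and \<gamma> :: "'v list"
    and X :: "'a topology"
    and act :: "int ^ 'd \<Rightarrow> 'a \<Rightarrow> 'a"
  assumes "pair_graph H"
    and "closed_vwalk H \<gamma>"
    and "odd (vwalk_length \<gamma>)"
    and "Pi1_star_class H \<gamma> [^]\<^bsub>Pi1_star H (hd \<gamma>)\<^esub> (2::nat) = \<one>\<^bsub>Pi1_star H (hd \<gamma>)\<^esub>"
    and "Polish_topology X"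
    and "zero_dimensional X"
    and "continuous_action X act"
    and "free_action X act"
  shows "\<exists>c. continuous_graph_hom X (schreier_graph X act) H c"
proof -
  have metr: "metrizable_space X"
    using assms(5) by (simp add: Polish_topology_def completely_metrizable_imp_metrizable_space)
  have "second_countable X"
    using metrizable_separable_imp_second_countable[OF metr] assms(5) by (simp add: Polish_topology_def)
  with metr have X: "Hausdorff_space X" "zero_dimensional X" "Lindelof_space X"
    using assms(6) by (auto intro: metrizable_imp_Hausdorff_space second_countable_imp_Lindelof_space)
  have sym: "sym (parcs H)" using pair_graph_arcs_sym[OF assms(1)] by (auto intro: symI)
  \<comment> \<open>The order of choices avoids a circle: the number of copies depends on the
    dimension only and determines \<open>M\<close>, \<open>f\<close> and \<open>c\<close>; then
    \<open>c\<close> gives \<open>\<Psi>\<close> and \<open>\<epsilon>\<close>,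
    \<open>\<epsilon>\<close> gives \<open>\<delta>\<close>, and \<open>\<delta>\<close> sets the
    scale of the markers.\<close>
  obtain M and f :: "(nat \<Rightarrow> complex) \<Rightarrow> complex \<times> real" and c where M: "M > 0" and c: "c > 0"
    and f: "\<And>w. w \<in> join_base M (marker_count TYPE('d)) \<Longrightarrow> norm (f w) \<ge> c"
    and unif: "\<forall>\<epsilon>>0. \<exists>\<delta>>0. \<forall>w\<in>join_base M (marker_count TYPE('d)). \<forall>w'\<in>join_base M (marker_count TYPE('d)).
       (\<forall>j<marker_count TYPE('d). norm (w' j - cis (2 * pi / M) * w j) \<le> \<delta>) \<longrightarrow> norm (f w + f w') \<le> \<epsilon>"
    using uniform_antipodal_join_map[of "marker_count TYPE('d)"] by (elim exE conjE) blast
  obtain \<epsilon> and \<Psi> :: "complex \<times> real \<Rightarrow> 'v" where \<epsilon>: "\<epsilon> > 0"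
    and \<Psi>: "\<And>k k'. norm k \<ge> c \<Longrightarrow> norm k' \<ge> c \<Longrightarrow> norm (k + k') \<le> \<epsilon> \<Longrightarrow> (\<Psi> k, \<Psi> k') \<in> parcs H"
  proof (rule cyclic_contraction[OF assms(1-3) squared_class_trivial_imp_contractible[OF assms(1,2,4)]])
    fix m T :: nat and p :: "nat \<Rightarrow> int \<Rightarrow> 'v" and u v
    assume p: "odd m" "\<And>s i. p s (i + 2 * int m) = p s i" "\<And>i. p 0 (i + int m) = p 0 i"
      "\<And>s i. (p s i, p s (i + 1)) \<in> parcs H"
      "\<And>s i. (p s i, p (Suc s) (i + 1)) \<in> parcs H" "\<And>s i. (p (Suc s) i, p s (i + 1)) \<in> parcs H"
      "\<And>s i. s \<ge> T \<Longrightarrow> p s i = (if even i then u else v)"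
    show thesis
      using antipodal_map_exists[of "parcs H" m p T u v c, OF sym p c] that by blast
  qed
  obtain \<delta> where \<delta>: "\<delta> > 0"
    and close: "\<And>w w'. w \<in> join_base M (marker_count TYPE('d)) \<Longrightarrow> w' \<in> join_base M (marker_count TYPE('d)) \<Longrightarrow>
       (\<And>j. norm (w' j - cis (2 * pi / M) * w j) \<le> \<delta>) \<Longrightarrow> norm (f w + f w') \<le> \<epsilon>"
    using unif \<epsilon> by metis
  obtain w :: "'a \<Rightarrow> nat \<Rightarrow> complex"
    where base: "\<And>x. x \<in> topspace X \<Longrightarrow> w x \<in> join_base M (marker_count TYPE('d))"
      and step: "\<And>x i j. x \<in> topspace X \<Longrightarrow> norm (w (act (axis i 1) x) j - cis (2 * pi / M) * w x j) \<le> \<delta>"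
      and loc: "\<And>x. x \<in> topspace X \<Longrightarrow> \<exists>U. openin X U \<and> x \<in> U \<and> (\<forall>y\<in>U. w y = w x)"
    using locally_constant_join_coordinates[OF X assms(7,8) M \<delta>] by metis
  define col where "col x = \<Psi> (f (w x))" for x
  have arc: "(col x, col (act (axis i 1) x)) \<in> parcs H" if x: "x \<in> topspace X" for x i
    unfolding col_def
    by (intro \<Psi> f close base x act_topspace[OF assms(7)] step)
  have "continuous_map X (discrete_topology (pverts H)) col"
    unfolding continuous_map_def
  proof (intro conjI allI impI)
    \<comment> \<open>There is at least one generator, so every colour is the end of an arc and
      hence a vertex.\<close>
    show "col \<in> topspace X \<rightarrow> topspace (discrete_topology (pverts H))"
      using arc pair_graph_arc_verts(1)[OF assms(1)] by fastforce
    fix V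
    show "openin X {x \<in> topspace X. col x \<in> V}"
    proof (subst openin_subopen, intro ballI)
      fix x assume x: "x \<in> {x \<in> topspace X. col x \<in> V}"
      then obtain U where U: "openin X U" "x \<in> U" "\<forall>y\<in>U. w y = w x" using loc by blast
      have "U \<subseteq> {x \<in> topspace X. col x \<in> V}"
      proof
        fix y assume "y \<in> U"
        with U(3) have "col y = col x" unfolding col_def by metis
        then show "y \<in> {x \<in> topspace X. col x \<in> V}"
          using x \<open>y \<in> U\<close> openin_subset[OF U(1)] by auto
      qed
      then show "\<exists>T. openin X T \<and> x \<in> T \<and> T \<subseteq> {x \<in> topspace X. col x \<in> V}" using U by blast
    qed
  qed
  moreover have "(col x, col y) \<in> parcs H" if "(x, y) \<in> parcs (schreier_graph X act)" for x y
    using that arc pair_graph_arcs_sym[OF assms(1)] by (auto simp: schreier_graph_def)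
  ultimately show ?thesis unfolding continuous_graph_hom_def by blast
qed

end
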